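(* Let $G$ be a mean-payoff game, $\lambda$ a requirement, $i\in\Pi$, $v_0\in V_i$ and $\beta\in\mathbb{N}$. In the reduced negotiation game $\mathsf{Red}^\beta_{\lambda i}(G)$ from $v_0$, Prover has an optimal strategy that is memoryless.
   Context: Mean-payoff game $G$: finite player set $\Pi$, finite directed graph $(V,E)$ with every vertex having an outgoing edge, partition $(V_i)_i$, rewards $r_i:E\to\mathbb{Q}$, payoff $\mu_i(\rho)=\liminf_n\frac1n\sum_{k<n}r_i(\rho_k\rho_{k+1})$. $\mathsf{Occ}(\rho)$ is the set of vertices occurring in $\rho$; $|h|$ is the number of vertices of a history $h$. A requirement is $\lambda:V\to\mathbb{R}\cup\{\pm\infty\}$; a play $\rho$ is $\lambda$-consistent if $\mu_j(\rho_{\ge n})\ge\lambda(\rho_n)$ for all $n$, $j$ with $\rho_n\in V_j$. Size of rationals: $\lVert p/q\rVert=1+\lceil\log_2(|p|+1)\rceil+\lceil\log_2(|q|+1)\rceil$ (coprime), size of tuples = number of entries + sum of entry sizes. Punishment family: for a simple history $h$, a nonempty simple cycle $c$, $W\subseteq V$, $\bar x\in\mathbb{R}^\Pi$, the set $hc^\infty\rho=\{hc^n\rho' : n>0,\ hc^n\rho'\text{ is a play},\ \mu(\rho')=\bar x,\ \mathsf{Occ}(\rho')=W\}$ (nonempty), for any play $\rho$ with $\mu(\rho)=\bar x$, $\mathsf{Occ}(\rho)=W$; $c$ is its punishing cycle; it is a $\beta$-punishment family if $\lVert\bar x\rVert\le\beta$; it is $\lambda$-consistent if its elements are; all its elements have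 payoff vector $\bar x$. Reduced negotiation game $\mathsf{Red}^\beta_{\lambda i}(G)$: two players, Prover and Challenger. Prover's states are the vertices of $V$. Challenger's states are: $[hc^\infty\rho]$ for each $\lambda$-consistent $\beta$-punishment family; $(c,u)$ where $c$ is the punishing cycle of such a family $hc^\infty\rho$ and some vertex of $\rho$ in $V_i$ has an edge to $u$; $[h'w]$ where $h'$ is a prefix of $hc$ for such a family, $\mathsf{last}(h')\in V_i$ and $\mathsf{last}(h')w\in E$; and two states $\top,\bot$. Transitions: $v\to[hc^\infty\rho]$ (Prover proposes a family whose plays start at $v$), $v\to\bot$ (Prover gives up), $[hc^\infty\rho]\to\top$ (Challenger accepts), $[hc^\infty\rho]\to[h'w]$ (pre-cycle deviation, $h'$ prefix of $hc$), $[hc^\infty\rho]\to(c,u)$ (post-cycle deviation), $[h'w]\to w$, $(c,u)\to u$, $\top\to\top$, $\bot\to\bot$. For a history or play $H=H_0H_1\dots$ not reaching $\bot$, define $\dot H=h^{(1)}h^{(2)}\dots$ in $G$ by: if $H_{k-1}H_k=v[hc^\infty\rho]$, or $[h'w]w$, or $(c,w)w$, then $h^{(k)}$ is empty; if $H_{k-1}H_k=[hc^\infty\rho]\top$, then $h^{(k)}h^{(k+1)}\dots=hc^{N^2}\rho$ with $N=|h^{(1)}\dots h^{(k-1)}h|$; if $H_{k-1}H_k=[hc^\infty\rho][h'w]$, then $h^{(k)}=h'$; if $H_{k-1}H_k=[hc^\infty\rho](c,w)$, then $h^{(k)}=hc^{N^2}h'$ with $N$ as before and $h'$ a shortest history with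 $\mathsf{Occ}(h')\subseteq\mathsf{Occ}(\rho)$, $\mathsf{last}(h')\in V_i$, $\mathsf{last}(h')w\in E$. Payoffs: $\nu_\mathbb{C}(\pi)=-\nu_\mathbb{P}(\pi)=+\infty$ if $\pi$ reaches $\bot$, and $\mu_i(\dot\pi)$ otherwise. A strategy is memoryless if its choice depends only on the current state; it is optimal for Prover if it attains $\inf_{\tau_\mathbb{P}}\sup_{\tau_\mathbb{C}}\nu_\mathbb{C}$. *)

theory Defs
  imports "HOL-Analysis.Analysis"
begin

text \<open>A mean-payoff game with player set the finite type 'p (Pi = UNIV),
  vertex set V, edges E, owner function (the partition V_j = owner^-1 j),
  and rewards r_j : E -> Q (given as real values that are rational on E).\<close>

record ('v, 'p) mpg =
  verts :: "'v set"
  edges :: "('v \<times> 'v) set"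
  owner :: "'v \<Rightarrow> 'p"
  rew   :: "'p \<Rightarrow> 'v \<times> 'v \<Rightarrow> real"

definition mp_game :: "('v, 'p::finite) mpg \<Rightarrow> bool" where
  "mp_game G \<longleftrightarrow> finite (verts G) \<and> edges G \<subseteq> verts G \<times> verts G
     \<and> (\<forall>v\<in>verts G. \<exists>w. (v, w) \<in> edges G)
     \<and> (\<forall>j. \<forall>e\<in>edges G. rew G j e \<in> \<rat>)"

definition is_play :: "('v, 'p) mpg \<Rightarrow> (nat \<Rightarrow> 'v) \<Rightarrow> bool" where
  "is_play G \<rho> \<longleftrightarrow> (\<forall>n. (\<rho> n, \<rho> (Suc n)) \<in> edges G)"

definition is_hist :: "('v, 'p) mpg \<Rightarrow> 'v list \<Rightarrow> bool" where
  "is_hist G h \<longleftrightarrow> h \<noteq> [] \<and> set h \<subseteq> verts G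
     \<and> (\<forall>k. Suc k < length h \<longrightarrow> (h ! k, h ! Suc k) \<in> edges G)"

definition simple_cycle :: "('v, 'p) mpg \<Rightarrow> 'v list \<Rightarrow> bool" where
  "simple_cycle G c \<longleftrightarrow> is_hist G c \<and> distinct c \<and> (last c, hd c) \<in> edges G"

definition mp :: "('v, 'p) mpg \<Rightarrow> 'p \<Rightarrow> (nat \<Rightarrow> 'v) \<Rightarrow> ereal" where
  "mp G j \<rho> = liminf (\<lambda>n. ereal ((\<Sum>k<n. rew G j (\<rho> k, \<rho> (Suc k))) / real n))"

definition suffix_from :: "(nat \<Rightarrow> 'v) \<Rightarrow> nat \<Rightarrow> nat \<Rightarrow> 'v" where
  "suffix_from \<rho> n = (\<lambda>k. \<rho> (k + n))"

definition lconc :: "'v list \<Rightarrow> (nat \<Rightarrow> 'v) \<Rightarrow> nat \<Rightarrow> 'v" where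
  "lconc l \<rho> = (\<lambda>n. if n < length l then l ! n else \<rho> (n - length l))"

definition cpow :: "'v list \<Rightarrow> nat \<Rightarrow> 'v list" where
  "cpow c n = concat (replicate n c)"

definition lam_consistent :: "('v, 'p) mpg \<Rightarrow> ('v \<Rightarrow> ereal) \<Rightarrow> (nat \<Rightarrow> 'v) \<Rightarrow> bool" where
  "lam_consistent G lam \<rho> \<longleftrightarrow>
     (\<forall>n. mp G (owner G (\<rho> n)) (suffix_from \<rho> n) \<ge> lam (\<rho> n))"

definition rat_size :: "rat \<Rightarrow> nat" where
  "rat_size q = (case quotient_of q of (p, d) \<Rightarrow>
     1 + nat \<lceil>log 2 (real_of_int \<bar>p\<bar> + 1)\<rceil> + nat \<lceil>log 2 (real_of_int \<bar>d\<bar> + 1)\<rceil>)"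

text \<open>Size of a vector in R^Pi; only meaningful (and only used) for rational vectors.\<close>
definition vec_size :: "('p::finite \<Rightarrow> real) \<Rightarrow> nat" where
  "vec_size x = CARD('p) + (\<Sum>j\<in>UNIV. rat_size (THE q. x j = of_rat q))"

text \<open>The family hc^\<infinity>\<rho> depends on \<rho> only through W = Occ(\<rho>) and x = \<mu>(\<rho>);
  it is represented by the tuple (h, c, W, x).\<close>

definition fam_set :: "('v, 'p) mpg \<Rightarrow> 'v list \<Rightarrow> 'v list \<Rightarrow> 'v set \<Rightarrow> ('p \<Rightarrow> real)
    \<Rightarrow> (nat \<Rightarrow> 'v) set" where
  "fam_set G h c W x = {lconc (h @ cpow c n) \<rho>' | n \<rho>'. n > 0
      \<and> is_play G (lconc (h @ cpow c n) \<rho>')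
      \<and> (\<forall>j. mp G j \<rho>' = ereal (x j)) \<and> range \<rho>' = W}"

definition punish_family :: "('v, 'p) mpg \<Rightarrow> 'v list \<Rightarrow> 'v list \<Rightarrow> 'v set \<Rightarrow> ('p \<Rightarrow> real)
    \<Rightarrow> bool" where
  "punish_family G h c W x \<longleftrightarrow> is_hist G h \<and> distinct h \<and> simple_cycle G c
     \<and> (\<exists>\<rho>. is_play G \<rho> \<and> (\<forall>j. mp G j \<rho> = ereal (x j)) \<and> range \<rho> = W)
     \<and> fam_set G h c W x \<noteq> {}"

definition good_family :: "('v, 'p::finite) mpg \<Rightarrow> ('v \<Rightarrow> ereal) \<Rightarrow> nat
    \<Rightarrow> 'v list \<Rightarrow> 'v list \<Rightarrow> 'v set \<Rightarrow> ('p \<Rightarrow> real) \<Rightarrow> bool" where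
  "good_family G lam \<beta> h c W x \<longleftrightarrow> punish_family G h c W x
     \<and> (\<forall>j. x j \<in> \<rat>) \<and> vec_size x \<le> \<beta>
     \<and> (\<forall>\<pi>\<in>fam_set G h c W x. lam_consistent G lam \<pi>)"

datatype ('v, 'p) rstate =
    PSt 'v
  | Fam "'v list" "'v list" "'v set" "'p \<Rightarrow> real"
  | Pre "'v list" 'v
  | Post "'v list" 'v
  | Top
  | Bot

definition is_prover_state :: "('v, 'p) rstate \<Rightarrow> bool" where
  "is_prover_state s = (case s of PSt _ \<Rightarrow> True | _ \<Rightarrow> False)"

definition red_edge :: "('v, 'p::finite) mpg \<Rightarrow> ('v \<Rightarrow> ereal) \<Rightarrow> 'p \<Rightarrow> nat
    \<Rightarrow> ('v, 'p) rstate \<Rightarrow> ('v, 'p) rstate \<Rightarrow> bool" where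
  "red_edge G lam i \<beta> s t = (case s of
       PSt v \<Rightarrow> v \<in> verts G \<and> (t = Bot \<or>
                 (\<exists>h c W x. t = Fam h c W x \<and> good_family G lam \<beta> h c W x \<and> hd h = v))
     | Fam h c W x \<Rightarrow> good_family G lam \<beta> h c W x \<and>
          (t = Top
           \<or> (\<exists>h' w. t = Pre h' w \<and> h' \<noteq> [] \<and> (\<exists>s'. h @ c = h' @ s')
                 \<and> owner G (last h') = i \<and> (last h', w) \<in> edges G)
           \<or> (\<exists>u. t = Post c u \<and> (\<exists>v\<in>W. owner G v = i \<and> (v, u) \<in> edges G)))
     | Pre h' w \<Rightarrow> t = PSt w
     | Post c u \<Rightarrow> t = PSt u
     | Top \<Rightarrow> t = Top
     | Bot \<Rightarrow> t = Bot)"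

definition red_hist :: "('v, 'p::finite) mpg \<Rightarrow> ('v \<Rightarrow> ereal) \<Rightarrow> 'p \<Rightarrow> nat \<Rightarrow> 'v
    \<Rightarrow> ('v, 'p) rstate list \<Rightarrow> bool" where
  "red_hist G lam i \<beta> v0 hs \<longleftrightarrow> hs \<noteq> [] \<and> hd hs = PSt v0
     \<and> (\<forall>k. Suc k < length hs \<longrightarrow> red_edge G lam i \<beta> (hs ! k) (hs ! Suc k))"

type_synonym ('v, 'p) rstrat = "('v, 'p) rstate list \<Rightarrow> ('v, 'p) rstate"

definition prover_strategy where
  "prover_strategy G lam i \<beta> v0 (\<sigma> :: ('v, 'p::finite) rstrat) \<longleftrightarrow>
     (\<forall>hs. red_hist G lam i \<beta> v0 hs \<and> is_prover_state (last hs)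
        \<longrightarrow> red_edge G lam i \<beta> (last hs) (\<sigma> hs))"

definition challenger_strategy where
  "challenger_strategy G lam i \<beta> v0 (\<tau> :: ('v, 'p::finite) rstrat) \<longleftrightarrow>
     (\<forall>hs. red_hist G lam i \<beta> v0 hs \<and> \<not> is_prover_state (last hs)
        \<longrightarrow> red_edge G lam i \<beta> (last hs) (\<tau> hs))"

definition memoryless_prover where
  "memoryless_prover G lam i \<beta> v0 (\<sigma> :: ('v, 'p::finite) rstrat) \<longleftrightarrow>
     (\<forall>hs hs'. red_hist G lam i \<beta> v0 hs \<and> red_hist G lam i \<beta> v0 hs'
        \<and> is_prover_state (last hs) \<and> last hs = last hs' \<longrightarrow> \<sigma> hs = \<sigma> hs')"

fun out_hist :: "('v, 'p) rstrat \<Rightarrow> ('v, 'p) rstrat \<Rightarrow> 'v \<Rightarrow> nat \<Rightarrow> ('v, 'p) rstate list" where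
  "out_hist \<sigma> \<tau> v0 0 = [PSt v0]"
| "out_hist \<sigma> \<tau> v0 (Suc n) = (let hs = out_hist \<sigma> \<tau> v0 n in
     hs @ [if is_prover_state (last hs) then \<sigma> hs else \<tau> hs])"

definition outcome :: "('v, 'p) rstrat \<Rightarrow> ('v, 'p) rstrat \<Rightarrow> 'v \<Rightarrow> nat \<Rightarrow> ('v, 'p) rstate" where
  "outcome \<sigma> \<tau> v0 n = last (out_hist \<sigma> \<tau> v0 n)"

text \<open>A shortest history h' with Occ(h') \<subseteq> W, last(h') in V_i, last(h') w in E,
  starting at a successor of last(c) (so that h c^(N^2) h' is a history).\<close>
definition post_cands :: "('v, 'p) mpg \<Rightarrow> 'p \<Rightarrow> 'v list \<Rightarrow> 'v set \<Rightarrow> 'v \<Rightarrow> 'v list set" where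
  "post_cands G i c W w = {h'. is_hist G h' \<and> (last c, hd h') \<in> edges G \<and> set h' \<subseteq> W
      \<and> owner G (last h') = i \<and> (last h', w) \<in> edges G}"

definition post_seg :: "('v, 'p) mpg \<Rightarrow> 'p \<Rightarrow> 'v list \<Rightarrow> 'v set \<Rightarrow> 'v \<Rightarrow> 'v list" where
  "post_seg G i c W w = (SOME h'. h' \<in> post_cands G i c W w
      \<and> (\<forall>g\<in>post_cands G i c W w. length h' \<le> length g))"

text \<open>The segment h^(k) for the step H_(k-1) H_k (k \<ge> 1), given the length L of
  h^(1)...h^(k-1); the step into Top is treated separately.\<close>
definition dot_seg :: "('v, 'p) mpg \<Rightarrow> 'p \<Rightarrow> (nat \<Rightarrow> ('v, 'p) rstate) \<Rightarrow> nat \<Rightarrow> nat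
    \<Rightarrow> 'v list" where
  "dot_seg G i H k L = (case H (k - 1) of
       Fam h c W x \<Rightarrow> (case H k of
           Pre h' w \<Rightarrow> h'
         | Post c' w \<Rightarrow> h @ cpow c ((L + length h)\<^sup>2) @ post_seg G i c W w
         | _ \<Rightarrow> [])
     | _ \<Rightarrow> [])"

fun dot_pref :: "('v, 'p) mpg \<Rightarrow> 'p \<Rightarrow> (nat \<Rightarrow> ('v, 'p) rstate) \<Rightarrow> nat \<Rightarrow> 'v list" where
  "dot_pref G i H 0 = []"
| "dot_pref G i H (Suc k) = dot_pref G i H k @ dot_seg G i H (Suc k) (length (dot_pref G i H k))"

definition dot_play :: "('v, 'p) mpg \<Rightarrow> 'p \<Rightarrow> (nat \<Rightarrow> ('v, 'p) rstate) \<Rightarrow> nat \<Rightarrow> 'v" where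
  "dot_play G i H = (if \<exists>k. H k = Top then
      (let k = (LEAST k. H k = Top) in
        (case H (k - 1) of
           Fam h c W x \<Rightarrow>
             (let P = dot_pref G i H (k - 1);
                  N = length P + length h;
                  \<rho> = (SOME \<rho>. is_play G \<rho> \<and> (\<forall>j. mp G j \<rho> = ereal (x j)) \<and> range \<rho> = W)
              in lconc (P @ h @ cpow c (N\<^sup>2)) \<rho>)
         | _ \<Rightarrow> undefined))
    else (\<lambda>n. dot_pref G i H (LEAST k. n < length (dot_pref G i H k)) ! n))"

definition nu_C :: "('v, 'p) mpg \<Rightarrow> 'p \<Rightarrow> (nat \<Rightarrow> ('v, 'p) rstate) \<Rightarrow> ereal" where
  "nu_C G i H = (if \<exists>k. H k = Bot then \<infinity> else mp G i (dot_play G i H))"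

definition prover_guarantee where
  "prover_guarantee G lam i \<beta> v0 (\<sigma> :: ('v, 'p::finite) rstrat) =
     (SUP \<tau> \<in> {\<tau>. challenger_strategy G lam i \<beta> v0 \<tau>}. nu_C G i (outcome \<sigma> \<tau> v0))"

definition optimal_prover where
  "optimal_prover G lam i \<beta> v0 (\<sigma> :: ('v, 'p::finite) rstrat) \<longleftrightarrow>
     prover_strategy G lam i \<beta> v0 \<sigma> \<and>
     prover_guarantee G lam i \<beta> v0 \<sigma> =
       (INF \<sigma>' \<in> {\<sigma>'. prover_strategy G lam i \<beta> v0 \<sigma>'}. prover_guarantee G lam i \<beta> v0 \<sigma>')"

end

theory Submission
  imports Defs
begin

text \<open>Fix a threshold \<open>\<alpha>\<close> and count rewards relative to \<open>\<alpha>\<close>. Since the punishing cycle is repeated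
  \<open>N\<^sup>2\<close> times, infinitely many post-cycle deviations on cycles of mean at most \<open>\<alpha>\<close> push the limit
  inferior down to \<open>\<alpha>\<close>, whereas a late post-cycle deviation on a cycle of mean at least \<open>\<alpha>\<close> wipes
  out, up to \<open>o(n)\<close>, whatever deficit Challenger had before. What remains, the pre-cycle deviations,
  is an energy game with finitely many vertices.

  Let \<open>\<sigma>\<close> be any strategy that guarantees less than \<open>\<alpha>\<close>, and let \<open>Z\<close> be the set of vertices reachable
  under \<open>\<sigma>\<close>. Take a maximal set \<open>Y\<close> on which Prover has a positional certificate (a rank for the
  expensive cycles, a potential for the energy, and cheap cycles leading back to \<open>Z\<close>). From a
  vertex of \<open>Z - Y\<close>, Challenger could forever keep the energy bounded below or use expensive
  cycles and obtain at least \<open>\<alpha>\<close> against \<open>\<sigma>\<close>; hence \<open>Z \<subseteq> Y\<close> and the certificate is a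
  memoryless strategy that guarantees at most \<open>\<alpha>\<close>. As there are only finitely many memoryless
  strategies, the best of them is optimal.\<close>

section \<open>Energy games\<close>

text \<open>Read \<open>b\<close> as the credit of a player who picks \<open>a\<close> in
  \<open>A v\<close>; the opponent answers with a pair in \<open>M a\<close> and charges
  \<open>w\<close>. The opponent wins once the credit is negative. A player without action loses at
  the next round, an opponent without answer cannot win from a nonnegative credit.\<close>

fun forces :: "('v \<Rightarrow> 'a set) \<Rightarrow> ('a \<Rightarrow> (real \<times> 'v) set) \<Rightarrow> nat \<Rightarrow> 'v \<Rightarrow> real \<Rightarrow> bool" where
  "forces A M 0 v b = (b < 0)"
| "forces A M (Suc n) v b = (b < 0 \<or> (\<forall>a\<in>A v. \<exists>(w, u)\<in>M a. forces A M n u (b - w)))"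

lemma forces_Suc: "forces A M n v b \<Longrightarrow> forces A M (Suc n) v b"
proof (induction n arbitrary: v b)
  case (Suc n)
  show ?case
  proof (cases "b < 0")
    case False
    then have "\<forall>a\<in>A v. \<exists>(w, u)\<in>M a. forces A M n u (b - w)"
      using Suc.prems by simp
    then have "\<forall>a\<in>A v. \<exists>(w, u)\<in>M a. forces A M (Suc n) u (b - w)"
      using Suc.IH by fast
    then show ?thesis by (subst forces.simps) blast
  qed simp
qed simp

lemma forces_mono: "n \<le> m \<Longrightarrow> forces A M n v b \<Longrightarrow> forces A M m v b"
  by (induction m rule: dec_induct) (auto simp del: forces.simps intro: forces_Suc)

lemma forces_antimono: "forces A M n v b \<Longrightarrow> b' \<le> b \<Longrightarrow> forces A M n v b'"
proof (induction n arbitrary: v b b')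
  case (Suc n)
  show ?case
  proof (cases "b' < 0")
    case False
    then have *: "\<forall>a\<in>A v. \<exists>(w, u)\<in>M a. forces A M n u (b - w)"
      using Suc.prems by simp
    have "\<exists>(w, u)\<in>M a. forces A M n u (b' - w)" if "a \<in> A v" for a
    proof -
      obtain w u where "(w, u) \<in> M a" "forces A M n u (b - w)"
        using * \<open>a \<in> A v\<close> by blast
      then show ?thesis
        using Suc.IH[of u "b - w" "b' - w"] Suc.prems(2) by auto
    qed
    then show ?thesis by simp
  qed simp
qed simp

text \<open>Finitely many actions have to be answered, so the least of their slacks is still
  positive. This openness makes the infimum of the safe credits itself safe.\<close>

lemma forces_open:
  assumes fin: "\<And>v. finite (A v)"
  shows "forces A M n v b \<Longrightarrow> \<exists>e>0. forces A M n v (b + e)"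
proof (induction n arbitrary: v b)
  case 0
  then show ?case by (intro exI[of _ "- b / 2"]) simp
next
  case (Suc n)
  show ?case
  proof (cases "b < 0")
    case True
    then show ?thesis by (intro exI[of _ "- b / 2"]) simp
  next
    case False
    have "\<exists>e w u. e > 0 \<and> (w, u) \<in> M a \<and> forces A M n u (b - w + e)" if "a \<in> A v" for a
    proof -
      obtain w u where "(w, u) \<in> M a" "forces A M n u (b - w)"
        using Suc.prems False \<open>a \<in> A v\<close> by auto
      then show ?thesis using Suc.IH[of u "b - w"] by blast
    qed
    then obtain e where e: "\<And>a. a \<in> A v \<Longrightarrow> e a > (0::real) \<and> (\<exists>w u. (w, u) \<in> M a \<and> forces A M n u (b - w + e a))"
      by metis
    define e0 where "e0 = Min (insert 1 (e ` A v))"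
    have e0: "e0 > 0" "\<And>a. a \<in> A v \<Longrightarrow> e0 \<le> e a"
      using fin[of v] e by (auto simp: e0_def)
    have "\<exists>(w, u)\<in>M a. forces A M n u (b + e0 - w)" if "a \<in> A v" for a
    proof -
      obtain w u where "(w, u) \<in> M a" "forces A M n u (b - w + e a)"
        using e \<open>a \<in> A v\<close> by blast
      then show ?thesis
        using forces_antimono[of A M n u "b - w + e a" "b + e0 - w"] e0(2)[OF \<open>a \<in> A v\<close>] by auto
    qed
    then show ?thesis using e0(1) by auto
  qed
qed

text \<open>The idea for the last part: where no finite credit protects the first
  player, the opponent gains more than any \<open>D + W\<close> in boundedly many rounds, and he stops as soon
  as his gain is positive; the credit \<open>D\<close> that is still enforceable then shows that he
  has not left the region.\<close>

lemma energy_dichotomy: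
  fixes A :: "'v \<Rightarrow> 'a set" and M :: "'a \<Rightarrow> (real \<times> 'v) set"
  assumes finV: "finite V" and finA: "\<And>v. finite (A v)"
    and step: "\<And>v a w u. v \<in> V \<Longrightarrow> a \<in> A v \<Longrightarrow> (w, u) \<in> M a \<Longrightarrow> u \<in> V \<and> \<bar>w\<bar> \<le> W"
  obtains U f K Inv where
    "U \<subseteq> V"
    "\<And>v. v \<in> U \<Longrightarrow> (0::real) \<le> f v"
    "\<And>v. v \<in> U \<Longrightarrow> \<exists>a\<in>A v. \<forall>(w, u)\<in>M a. u \<in> U \<and> f u \<le> f v - w"
    "\<And>v. v \<in> V - U \<Longrightarrow> Inv v 0"
    "\<And>v t. Inv v t \<Longrightarrow> - K \<le> (t::real)"
    "\<And>v t a. Inv v t \<Longrightarrow> a \<in> A v \<Longrightarrow> \<exists>(w, u)\<in>M a. Inv u (t + w)"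
proof -
  define safe where "safe v b \<longleftrightarrow> (\<forall>n. \<not> forces A M n v b)" for v b
  have safe_mono: "safe v b'" if "safe v b" "b \<le> b'" for v b b'
    using that forces_antimono[of A M _ v b' b] unfolding safe_def by metis
  have safe_nonneg: "0 \<le> b" if "safe v b" for v b
    using that[unfolded safe_def, rule_format, of 0] by simp
  \<comment> \<open>If every action could be punished, each within its own number of rounds,
    finiteness of \<open>A v\<close> would give one number that serves for all.\<close>
  have safe_step: "\<exists>a\<in>A v. \<forall>(w, u)\<in>M a. safe u (b - w)" if s: "safe v b" for v b
  proof (rule ccontr)
    assume "\<not> ?thesis"
    then have "\<forall>a\<in>A v. \<exists>n w u. (w, u) \<in> M a \<and> forces A M n u (b - w)"
      unfolding safe_def by fast
    then obtain n where n: "\<And>a. a \<in> A v \<Longrightarrow> \<exists>w u. (w, u) \<in> M a \<and> forces A M (n a) u (b - w)"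
      by metis
    define N where "N = (\<Sum>a\<in>A v. n a)"
    have "n a \<le> N" if "a \<in> A v" for a
      unfolding N_def using finA that by (intro member_le_sum) auto
    then have "\<exists>(w, u)\<in>M a. forces A M N u (b - w)" if "a \<in> A v" for a
      using n[OF that] forces_mono[of "n a" N A M] that by fast
    then have "forces A M (Suc N) v b" by simp
    then show False using s unfolding safe_def by blast
  qed
  define U where "U = {v \<in> V. \<exists>b. safe v b}"
  define f where "f v = Inf {b. safe v b}" for v
  have bdd: "bdd_below {b. safe v b}" for v
    using safe_nonneg by (auto intro!: bdd_belowI[of _ 0])
  have f_least: "f v \<le> b" if "safe v b" for v b
    unfolding f_def using that bdd by (intro cInf_lower) auto
  have f_safe: "safe v (f v)" if "v \<in> U" for v
  proof (rule ccontr)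
    assume "\<not> ?thesis"
    then obtain n e where e: "e > 0" "forces A M n v (f v + e)"
      using forces_open[of A M _ v "f v", OF finA] unfolding safe_def by blast
    have "{b. safe v b} \<noteq> {}" using that unfolding U_def by auto
    then obtain b where "safe v b" "b < f v + e"
      using cInf_lessD[of "{b. safe v b}" "f v + e"] e(1) unfolding f_def by auto
    then show False using forces_antimono[OF e(2), of b] unfolding safe_def by auto
  qed
  \<comment> \<open>A single credit that is safe at all vertices of \<open>U\<close> at
    once.\<close>
  define D where "D = (\<Sum>u\<in>U. f u)"
  have finU: "finite U" using finV unfolding U_def by simp
  have D: "safe u D" if "u \<in> U" for u
  proof (rule safe_mono[OF f_safe[OF that]])
    show "f u \<le> D" unfolding D_def
      using finU that safe_nonneg[OF f_safe] by (intro member_le_sum) auto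
  qed
  have D0: "0 \<le> D" unfolding D_def using safe_nonneg[OF f_safe] by (intro sum_nonneg) auto
  \<comment> \<open>When no moves exist at all, the assumptions allow a negative
    \<open>W\<close>.\<close>
  define W' where "W' = max W 0"
  have "\<exists>n. forces A M n v (D + W')" if "v \<in> V - U" for v
    using that unfolding U_def safe_def by blast
  then obtain n where n: "\<And>v. v \<in> V - U \<Longrightarrow> forces A M (n v) v (D + W')"
    by metis
  define nm where "nm = (\<Sum>v\<in>V. n v)"
  have nm: "forces A M nm v (D + W')" if "v \<in> V - U" for v
  proof (rule forces_mono[OF _ n[OF that]])
    show "n v \<le> nm" unfolding nm_def using finV that by (intro member_le_sum) auto
  qed
  have notU: "u \<notin> U" if "forces A M m u b" "D \<le> b" for u m b
    using D[of u] forces_antimono[OF that] unfolding safe_def by blast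
  \<comment> \<open>Here \<open>t\<close> is the total gain of the opponent and \<open>s\<close> a
    lower bound that counts from the last restart, with \<open>m\<close> of \<open>nm\<close> rounds
    left. Past phases ended with a positive gain, hence \<open>s \<le> t\<close>; a phase loses at
    most \<open>W'\<close> per round, which bounds \<open>t\<close> from below.\<close>
  define Inv where "Inv v t \<longleftrightarrow> v \<in> V \<and> (\<exists>m s. m \<le> nm \<and> s \<le> 0 \<and> s \<le> t
      \<and> - W' * (real nm - real m) \<le> s \<and> forces A M m v (D + W' - s))" for v t
  have W'0: "0 \<le> W'" unfolding W'_def by simp
  show thesis
  proof (rule that[of U f Inv "W' * real nm"])
    show "U \<subseteq> V" unfolding U_def by auto
    show "0 \<le> f v" if "v \<in> U" for v using safe_nonneg f_safe that by blast
    show "\<exists>a\<in>A v. \<forall>(w, u)\<in>M a. u \<in> U \<and> f u \<le> f v - w" if v: "v \<in> U" for v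
    proof -
      obtain a where a: "a \<in> A v" "\<forall>(w, u)\<in>M a. safe u (f v - w)"
        using safe_step[OF f_safe[OF v]] by blast
      have "u \<in> U \<and> f u \<le> f v - w" if "(w, u) \<in> M a" for w u
        using a that step[of v a w u] v f_least unfolding U_def by auto
      then show ?thesis using a(1) by blast
    qed
    show "Inv v 0" if "v \<in> V - U" for v
      unfolding Inv_def using nm[OF that] that W'0
      by (intro conjI exI[of _ nm] exI[of _ "0::real"]) auto
    show "- (W' * real nm) \<le> t" if I: "Inv v t" for v t
    proof -
      obtain m s where "s \<le> t" "- W' * (real nm - real m) \<le> s" 
        using I unfolding Inv_def by blast
      moreover have "0 \<le> W' * real m" using W'0 by simp
      ultimately show ?thesis by (simp add: algebra_simps)
    qed
    show "\<exists>(w, u)\<in>M a. Inv u (t + w)" if I: "Inv v t" and a: "a \<in> A v" for v t a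
    proof -
      obtain m s where ms: "m \<le> nm" "s \<le> 0" "s \<le> t" "- W' * (real nm - real m) \<le> s"
        "forces A M m v (D + W' - s)" and v: "v \<in> V"
        using I unfolding Inv_def by blast
      obtain m' where m': "m = Suc m'"
        using ms(2,5) D0 W'0 by (cases m) auto
      obtain w u where wu: "(w, u) \<in> M a" "forces A M m' u (D + W' - s - w)"
        using ms(2,5) D0 W'0 a unfolding m' by (auto simp: not_less)
      have u: "u \<in> V" "\<bar>w\<bar> \<le> W'" using step[OF v a wu(1)] unfolding W'_def by auto
      have "Inv u (t + w)"
      proof (cases "s + w \<le> 0")
        case True
        have "- W' * (real nm - real m') \<le> s + w"
          using ms(4) u(2) unfolding m' by (simp add: algebra_simps)
        then show ?thesis
          unfolding Inv_def using u ms True wu(2) m'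
          by (intro conjI exI[of _ m'] exI[of _ "s + w"]) (auto simp: algebra_simps)
      next
        case False
        \<comment> \<open>The phase ends with a positive gain. As \<open>s \<le> 0\<close> and
          \<open>w \<le> W'\<close>, the opponent still beats a credit of at least \<open>D\<close>
          from \<open>u\<close>, which is impossible inside \<open>U\<close>; a fresh phase can
          start.\<close>
        have "u \<in> V - U" using notU[OF wu(2)] u ms(2) by auto
        then show ?thesis
          unfolding Inv_def using nm[of u] False ms(3)
          by (intro conjI exI[of _ nm] exI[of _ "0::real"]) auto
      qed
      then show ?thesis using wu(1) by blast
    qed
  qed
qed

section \<open>Mean payoffs\<close>

definition psum :: "('v \<times> 'v \<Rightarrow> real) \<Rightarrow> (nat \<Rightarrow> 'v) \<Rightarrow> nat \<Rightarrow> real" where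
  "psum g \<rho> n = (\<Sum>k<n. g (\<rho> k, \<rho> (Suc k)))"

lemma psum_shift: "psum g \<rho> (m + n) = psum g \<rho> m + (\<Sum>k<n. g (\<rho> (m + k), \<rho> (Suc (m + k))))"
  unfolding psum_def by (induction n) auto

lemma mean_eq_psum:
  assumes "n > 0"
  shows "(\<Sum>k<n. r (\<rho> k, \<rho> (Suc k))) / real n = \<alpha> + psum (\<lambda>e. r e - \<alpha>) \<rho> n / real n"
  using assms by (simp add: psum_def sum_subtractf field_simps)

text \<open>Clearing the denominator turns the limit inferior into a statement on partial sums of
  rewards relative to \<open>\<alpha>\<close>: any sublinear deficit is allowed.\<close>

lemma mp_ge_iff:
  "ereal \<alpha> \<le> mp G j \<rho> \<longleftrightarrow>
    (\<forall>\<epsilon>>0. eventually (\<lambda>n. - \<epsilon> * real n < psum (\<lambda>e. rew G j e - \<alpha>) \<rho> n) sequentially)"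
proof -
  let ?T = "psum (\<lambda>e. rew G j e - \<alpha>) \<rho>"
  let ?X = "\<lambda>n. (\<Sum>k<n. rew G j (\<rho> k, \<rho> (Suc k))) / real n"
  have *: "eventually (\<lambda>n. - \<epsilon> * real n < ?T n) sequentially \<longleftrightarrow>
      eventually (\<lambda>n. \<alpha> - \<epsilon> < ?X n) sequentially" for \<epsilon>
  proof (rule eventually_cong[OF eventually_gt_at_top[of 0]])
    fix n :: nat assume "0 < n"
    then show "(- \<epsilon> * real n < ?T n) = (\<alpha> - \<epsilon> < ?X n)"
      unfolding mean_eq_psum[of n "rew G j" \<rho> \<alpha>, OF \<open>0 < n\<close>]
      by (auto simp: field_simps)
  qed
  show ?thesis
  proof
    assume le: "ereal \<alpha> \<le> mp G j \<rho>"
    show "\<forall>\<epsilon>>0. eventually (\<lambda>n. - \<epsilon> * real n < ?T n) sequentially"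
    proof (intro allI impI)
      fix \<epsilon> :: real assume "\<epsilon> > 0"
      then have "ereal (\<alpha> - \<epsilon>) < ereal \<alpha>" by simp
      then have "eventually (\<lambda>n. ereal (\<alpha> - \<epsilon>) < ereal (?X n)) sequentially"
        using le unfolding mp_def le_Liminf_iff by blast
      then show "eventually (\<lambda>n. - \<epsilon> * real n < ?T n) sequentially"
        unfolding * by simp
    qed
  next
    assume ev: "\<forall>\<epsilon>>0. eventually (\<lambda>n. - \<epsilon> * real n < ?T n) sequentially"
    show "ereal \<alpha> \<le> mp G j \<rho>"
      unfolding mp_def le_Liminf_iff
    proof (intro allI impI)
      fix y assume "y < ereal \<alpha>"
      then obtain z where z: "y < ereal z" "ereal z < ereal \<alpha>"
        using ereal_dense2 by blast
      have "eventually (\<lambda>n. \<alpha> - (\<alpha> - z) < ?X n) sequentially"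
        using ev[rule_format, of "\<alpha> - z"] z(2) unfolding * by simp
      then show "eventually (\<lambda>n. y < ereal (?X n)) sequentially"
        by (rule eventually_mono) (use z(1) in \<open>auto intro: less_trans\<close>)
    qed
  qed
qed

lemma mp_le:
  assumes "\<And>\<epsilon>. \<epsilon> > 0 \<Longrightarrow> frequently (\<lambda>n. psum (\<lambda>e. rew G j e - \<alpha>) \<rho> n \<le> \<epsilon> * real n) sequentially"
  shows "mp G j \<rho> \<le> ereal \<alpha>"
proof (rule ccontr)
  assume "\<not> ?thesis"
  then obtain z where z: "ereal \<alpha> < ereal z" "ereal z < mp G j \<rho>"
    using ereal_dense2 by (meson not_le)
  \<comment> \<open>Half of the gap: passing from threshold \<open>z\<close> to
    \<open>\<alpha>\<close> changes the sum by \<open>2 * ?e * n\<close>, so one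
    \<open>?e * n\<close> is left for the contradiction.\<close>
  let ?e = "(z - \<alpha>) / 2"
  have e: "?e > 0" using z(1) by simp
  have "eventually (\<lambda>n. - ?e * real n < psum (\<lambda>e. rew G j e - z) \<rho> n) sequentially"
    using z(2) mp_ge_iff[of z G j \<rho>] e by (meson less_imp_le)
  then have "eventually (\<lambda>n. \<not> psum (\<lambda>e. rew G j e - \<alpha>) \<rho> n \<le> ?e * real n) sequentially"
  proof (rule eventually_mono)
    fix n assume "- ?e * real n < psum (\<lambda>e. rew G j e - z) \<rho> n"
    moreover have "psum (\<lambda>e. rew G j e - z) \<rho> n = psum (\<lambda>e. rew G j e - \<alpha>) \<rho> n - 2 * ?e * real n"
      by (simp add: psum_def sum_subtractf field_simps)
    ultimately show "\<not> psum (\<lambda>e. rew G j e - \<alpha>) \<rho> n \<le> ?e * real n"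
      by (simp add: field_simps)
  qed
  then show False using assms[OF e] unfolding frequently_def by blast
qed

lemma lconc_Nil [simp]: "lconc [] \<rho> = \<rho>"
  by (simp add: lconc_def)

lemma lconc_append: "lconc (l @ l') \<rho> = lconc l (lconc l' \<rho>)"
  by (auto simp: lconc_def nth_append fun_eq_iff)

lemma psum_lconc_Cons: "psum g (lconc [a] \<rho>) (Suc n) = g (a, \<rho> 0) + psum g \<rho> n"
  unfolding psum_def by (subst sum.lessThan_Suc_shift) (simp add: lconc_def)

lemma psum_abs_le:
  assumes "\<And>k. \<bar>g (\<rho> k, \<rho> (Suc k))\<bar> \<le> D"
  shows "\<bar>psum g \<rho> (m + n) - psum g \<rho> m\<bar> \<le> D * real n"
proof -
  have "\<bar>\<Sum>k<n. g (\<rho> (m + k), \<rho> (Suc (m + k)))\<bar> \<le> (\<Sum>k<n. \<bar>g (\<rho> (m + k), \<rho> (Suc (m + k)))\<bar>)"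
    by (rule sum_abs)
  also have "\<dots> \<le> (\<Sum>k<n. D)" by (rule sum_mono) (rule assms)
  finally show ?thesis by (simp add: psum_shift mult.commute)
qed

text \<open>Prefix independence. One extra vertex changes the partial sums by a constant and an
  index shift, both absorbed by half of \<open>\<epsilon> * n\<close>; longer prefixes follow by
  induction.\<close>

lemma mp_lconc: "mp G j (lconc l \<rho>) = mp G j \<rho>"
proof -
  have single: "ereal \<alpha> \<le> mp G j (lconc [a] \<rho>) \<longleftrightarrow> ereal \<alpha> \<le> mp G j \<rho>" for a \<rho> \<alpha>
  proof -
    let ?g = "\<lambda>e. rew G j e - \<alpha>"
    let ?T = "psum ?g \<rho>" and ?d = "?g (a, \<rho> 0)"
    have "ereal \<alpha> \<le> mp G j (lconc [a] \<rho>) \<longleftrightarrow>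
       (\<forall>\<epsilon>>0. eventually (\<lambda>n. - \<epsilon> * real n < psum ?g (lconc [a] \<rho>) n) sequentially)"
      by (rule mp_ge_iff)
    also have "\<dots> \<longleftrightarrow> (\<forall>\<epsilon>>0. eventually (\<lambda>n. - \<epsilon> * (real n + 1) < ?d + ?T n) sequentially)"
      by (subst eventually_sequentially_Suc[symmetric]) (simp add: psum_lconc_Cons add.commute)
    also have "\<dots> \<longleftrightarrow> (\<forall>\<epsilon>>0. eventually (\<lambda>n. - \<epsilon> * real n < ?T n) sequentially)"
    proof (intro iffI allI impI)
      fix \<epsilon> :: real assume e: "\<epsilon> > 0"
        and *: "\<forall>\<epsilon>>0. eventually (\<lambda>n. - \<epsilon> * (real n + 1) < ?d + ?T n) sequentially"
      have 1: "eventually (\<lambda>n. - (\<epsilon>/2) * (real n + 1) < ?d + ?T n) sequentially"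
        using *[rule_format, of "\<epsilon>/2"] e by simp
      have 2: "eventually (\<lambda>n. (?d + \<epsilon>/2) / (\<epsilon>/2) < real n) sequentially"
        using filterlim_at_top_dense filterlim_real_sequentially by blast
      show "eventually (\<lambda>n. - \<epsilon> * real n < ?T n) sequentially"
        using 1 2
      proof eventually_elim
        case (elim n)
        have "?d + \<epsilon>/2 < (\<epsilon>/2) * real n" using elim(2) e by (simp add: field_simps)
        moreover have "- (\<epsilon>/2) * (real n + 1) = - \<epsilon> * real n + (\<epsilon>/2) * real n - \<epsilon>/2"
          by (simp add: field_simps)
        ultimately show ?case using elim(1) by linarith
      qed
    next
      fix \<epsilon> :: real assume e: "\<epsilon> > 0"
        and *: "\<forall>\<epsilon>>0. eventually (\<lambda>n. - \<epsilon> * real n < ?T n) sequentially"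
      have 1: "eventually (\<lambda>n. - (\<epsilon>/2) * real n < ?T n) sequentially"
        using *[rule_format, of "\<epsilon>/2"] e by simp
      have 2: "eventually (\<lambda>n. (- ?d) / (\<epsilon>/2) < real n) sequentially"
        using filterlim_at_top_dense filterlim_real_sequentially by blast
      show "eventually (\<lambda>n. - \<epsilon> * (real n + 1) < ?d + ?T n) sequentially"
        using 1 2
      proof eventually_elim
        case (elim n)
        have "- ?d < (\<epsilon>/2) * real n" using elim(2) e by (simp add: field_simps)
        moreover have "- \<epsilon> * (real n + 1) = - (\<epsilon>/2) * real n - (\<epsilon>/2) * real n - \<epsilon>"
          by (simp add: field_simps)
        ultimately show ?case using elim(1) e by linarith
      qed
    qed
    also have "\<dots> \<longleftrightarrow> ereal \<alpha> \<le> mp G j \<rho>" by (rule mp_ge_iff[symmetric])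
    finally show ?thesis .
  qed
  \<comment> \<open>Extended reals are determined by their real lower bounds, so thresholds suffice
    to compare payoffs.\<close>
  have eq: "a = b" if "\<And>\<alpha>. ereal \<alpha> \<le> a \<longleftrightarrow> ereal \<alpha> \<le> b" for a b :: ereal
  proof (rule order_antisym)
    show "a \<le> b"
      using that ereal_dense2[of b a] by (meson less_le_not_le not_le order.trans)
    show "b \<le> a"
      using that ereal_dense2[of a b] by (meson less_le_not_le not_le order.trans)
  qed
  have "mp G j (lconc [a] \<rho>) = mp G j \<rho>" for a \<rho>
    using single by (intro eq)
  then show ?thesis
  proof (induction l)
    case (Cons a l)
    then show ?case using lconc_append[of "[a]" l \<rho>] by simp
  qed simp
qed

section \<open>Plays of the reduced negotiation game\<close>

text \<open>The edge leaving \<open>h\<close> towards \<open>u\<close> is included, so that the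
  weights of successive rounds, where \<open>u\<close> opens the next segment, add up without a
  gap.\<close>

definition pre_weight :: "('v \<times> 'v \<Rightarrow> real) \<Rightarrow> 'v list \<Rightarrow> 'v \<Rightarrow> real" where
  "pre_weight g h u = (\<Sum>k<length h. g ((h @ [u]) ! k, (h @ [u]) ! Suc k))"

definition cycle_weight :: "('v \<times> 'v \<Rightarrow> real) \<Rightarrow> 'v list \<Rightarrow> real" where
  "cycle_weight g c = (\<Sum>k<length c. g (c ! k, c ! (Suc k mod length c)))"

lemma psum_history:
  assumes "\<And>k. k \<le> length h \<Longrightarrow> \<rho> (p + k) = (h @ [u]) ! k"
  shows "psum g \<rho> (p + length h) = psum g \<rho> p + pre_weight g h u"
proof -
  have "g (\<rho> (p + k), \<rho> (Suc (p + k))) = g ((h @ [u]) ! k, (h @ [u]) ! Suc k)" if "k < length h" for k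
    using assms[of k] assms[of "Suc k"] that by simp
  then show ?thesis by (simp add: psum_shift pre_weight_def)
qed

text \<open>The assumption covers \<open>q = m * length c\<close> as well: the play has to be back
  at the first vertex of \<open>c\<close>, otherwise the closing edge of the last turn would be
  missing.\<close>

lemma psum_cycle:
  assumes "c \<noteq> []" and "\<And>q. q \<le> m * length c \<Longrightarrow> \<rho> (p + q) = c ! (q mod length c)"
  shows "psum g \<rho> (p + m * length c) = psum g \<rho> p + real m * cycle_weight g c"
  using assms(2)
proof (induction m)
  case (Suc m)
  have "g (\<rho> (p + m * length c + k), \<rho> (Suc (p + m * length c + k))) = g (c ! k, c ! (Suc k mod length c))"
    if "k < length c" for k
  proof -
    have "\<rho> (p + (m * length c + k)) = c ! ((m * length c + k) mod length c)"
      using that by (intro Suc.prems) simp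
    moreover have "\<rho> (p + (m * length c + Suc k)) = c ! ((m * length c + Suc k) mod length c)"
      using that by (intro Suc.prems) simp
    moreover have "(m * length c + k) mod length c = k" "(m * length c + Suc k) mod length c = Suc k mod length c"
      using that by (simp_all only: mod_mult_self3 mod_less)
    ultimately show ?thesis by (simp add: add.assoc)
  qed
  then have "psum g \<rho> (p + m * length c + length c) = psum g \<rho> (p + m * length c) + cycle_weight g c"
    by (simp add: psum_shift cycle_weight_def)
  moreover have "psum g \<rho> (p + m * length c) = psum g \<rho> p + real m * cycle_weight g c"
    by (intro Suc.IH Suc.prems) simp
  ultimately show ?case by (simp add: algebra_simps)
qed simp

lemma length_cpow [simp]: "length (cpow c n) = n * length c"
  by (induction n) (auto simp: cpow_def)

lemma nth_cpow: "q < n * length c \<Longrightarrow> cpow c n ! q = c ! (q mod length c)"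
proof (induction n arbitrary: q)
  case (Suc n)
  have cp: "cpow c (Suc n) = c @ cpow c n" by (simp add: cpow_def)
  show ?case
  proof (cases "q < length c")
    case False
    then have "cpow c n ! (q - length c) = c ! ((q - length c) mod length c)"
      using Suc.prems by (intro Suc.IH) auto
    then show ?thesis using False by (simp add: cp nth_append le_mod_geq)
  qed (simp add: cp nth_append)
qed simp

lemma dot_pref_mono: "k \<le> k' \<Longrightarrow> \<exists>l. dot_pref G i H k' = dot_pref G i H k @ l"
  by (induction k' rule: dec_induct) auto

text \<open>The play is read off the first prefix that is long enough; prefixes only grow, so any
  other long enough one gives the same vertex.\<close>

lemma dot_play_nth:
  assumes "\<And>k. H k \<noteq> Top" and n: "n < length (dot_pref G i H k)"
  shows "dot_play G i H n = dot_pref G i H k ! n"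
proof -
  define k0 where "k0 = (LEAST k. n < length (dot_pref G i H k))"
  have k0: "n < length (dot_pref G i H k0)" "k0 \<le> k"
    unfolding k0_def using n by (rule LeastI, rule Least_le)
  obtain l where "dot_pref G i H k = dot_pref G i H k0 @ l"
    using dot_pref_mono[OF k0(2), of G i H] by blast
  moreover have "dot_play G i H n = dot_pref G i H k0 ! n"
    unfolding dot_play_def k0_def using assms(1) by simp
  ultimately show ?thesis using k0(1) by (simp add: nth_append)
qed

section \<open>Finiteness of the set of families\<close>

lemma finite_rat_size: "finite {q. rat_size q \<le> b}"
proof -
  have bound: "\<bar>p\<bar> \<le> 2 ^ b" if "nat \<lceil>log 2 (real_of_int \<bar>p\<bar> + 1)\<rceil> \<le> b" for p :: int
  proof -
    have "log 2 (real_of_int \<bar>p\<bar> + 1) \<le> real b" using that by linarith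
    then have "real_of_int \<bar>p\<bar> + 1 \<le> 2 powr real b"
      by (subst (asm) log_le_iff) auto
    then have "real_of_int \<bar>p\<bar> \<le> real_of_int (2 ^ b)"
      by (simp add: powr_realpow)
    then show ?thesis by (simp only: of_int_le_iff)
  qed
  have "{q. rat_size q \<le> b} \<subseteq> (\<lambda>(p, d). Fract p d) ` ({- (2 ^ b)..2 ^ b} \<times> {- (2 ^ b)..2 ^ b})"
  proof
    fix q assume q: "q \<in> {q. rat_size q \<le> b}"
    obtain p d where pd: "quotient_of q = (p, d)" by fastforce
    have "\<bar>p\<bar> \<le> 2 ^ b" "\<bar>d\<bar> \<le> 2 ^ b"
      using q by (auto simp only: rat_size_def pd mem_Collect_eq prod.case intro!: bound)
    moreover have "q = Fract p d"
      using pd quotient_of_div[OF pd] by (simp add: Fract_of_int_quotient)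
    ultimately show "q \<in> (\<lambda>(p, d). Fract p d) ` ({- (2 ^ b)..2 ^ b} \<times> {- (2 ^ b)..2 ^ b})"
      by (intro image_eqI[of _ _ "(p, d)"]) auto
  qed
  then show ?thesis by (rule finite_subset) simp
qed

lemma finite_vec_size: "finite {x :: 'p::finite \<Rightarrow> real. (\<forall>j. x j \<in> \<rat>) \<and> vec_size x \<le> b}"
proof -
  let ?R = "of_rat ` {q. rat_size q \<le> b} :: real set"
  have "x j \<in> ?R" if "\<forall>j. x j \<in> \<rat>" "vec_size x \<le> b" for x :: "'p \<Rightarrow> real" and j
  proof -
    obtain q where q: "x j = of_rat q" using \<open>\<forall>j. x j \<in> \<rat>\<close> unfolding Rats_def by blast
    then have "(THE q. x j = of_rat q) = q" by auto
    moreover have "rat_size (THE q. x j = of_rat q) \<le> (\<Sum>j\<in>UNIV. rat_size (THE q. x j = of_rat q))"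
      by (rule member_le_sum) auto
    ultimately have "rat_size q \<le> b" using that(2) unfolding vec_size_def by simp
    then show ?thesis using q by auto
  qed
  then have "{x :: 'p \<Rightarrow> real. (\<forall>j. x j \<in> \<rat>) \<and> vec_size x \<le> b} \<subseteq> PiE UNIV (\<lambda>_. ?R)"
    by auto
  moreover have "finite (PiE (UNIV :: 'p set) (\<lambda>_. ?R))"
    using finite_rat_size by (intro finite_PiE) auto
  ultimately show ?thesis by (rule finite_subset)
qed

locale red_game =
  fixes G :: "('v, 'p::finite) mpg" and lam :: "'v \<Rightarrow> ereal" and i :: 'p and \<beta> :: nat and v0 :: 'v
  assumes mpg: "mp_game G" and v0: "v0 \<in> verts G"
begin

abbreviation "V \<equiv> verts G"
abbreviation "good \<equiv> good_family G lam \<beta>"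
abbreviation "redge \<equiv> red_edge G lam i \<beta>"

lemma finite_V: "finite V" and edges_V: "(a, b) \<in> edges G \<Longrightarrow> a \<in> V \<and> b \<in> V"
  using mpg unfolding mp_game_def by auto

definition lists_V :: "'v list set" where
  "lists_V = {l. set l \<subseteq> V \<and> length l \<le> card V}"

lemma finite_lists_V: "finite lists_V"
  unfolding lists_V_def using finite_V by (rule finite_lists_length_le)

lemma good_h: "good h c W x \<Longrightarrow> h \<noteq> [] \<and> h \<in> lists_V"
  and good_c: "good h c W x \<Longrightarrow> c \<noteq> [] \<and> c \<in> lists_V"
  unfolding good_family_def punish_family_def is_hist_def simple_cycle_def lists_V_def
  by (auto simp: distinct_card[symmetric] intro!: card_mono finite_V)

lemma good_W:
  assumes "good h c W x"
  shows "W \<subseteq> V"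
proof -
  obtain \<rho> where "is_play G \<rho>" "range \<rho> = W"
    using assms unfolding good_family_def punish_family_def by blast
  then show ?thesis using edges_V unfolding is_play_def by blast
qed

text \<open>Representing the play by its vertex set and payoff vector pays off here: simple lists,
  subsets of \<open>V\<close> and rational vectors of bounded size are each finite in number. Prover
  thus has finitely many moves.\<close>

lemma finite_good: "finite {(h, c, W, x). good h c W x}"
proof (rule finite_subset)
  show "{(h, c, W, x). good h c W x} \<subseteq>
      lists_V \<times> lists_V \<times> Pow V \<times> {x. (\<forall>j. x j \<in> \<rat>) \<and> vec_size x \<le> \<beta>}"
    using good_h good_c good_W unfolding good_family_def by blast
  show "finite (lists_V \<times> lists_V \<times> Pow V \<times> {x :: 'p \<Rightarrow> real. (\<forall>j. x j \<in> \<rat>) \<and> vec_size x \<le> \<beta>})"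
    by (intro finite_cartesian_product finite_lists_V finite_vec_size) (simp add: finite_V)
qed

text \<open>Makes the choice in \<open>post_seg\<close> meaningful. An element of the family
  contains a play with vertex set \<open>W\<close> that is entered right after a copy of
  \<open>c\<close>; following it up to \<open>v\<close> yields a candidate.\<close>

lemma post_seg_in:
  assumes g: "good h c W x" and v: "v \<in> W" "owner G v = i" "(v, u) \<in> edges G"
  shows "post_seg G i c W u \<in> post_cands G i c W u"
proof -
  obtain n \<rho> where n: "n > 0" "is_play G (lconc (h @ cpow c n) \<rho>)" and W: "range \<rho> = W"
    using g unfolding good_family_def punish_family_def fam_set_def by auto
  have c: "c \<noteq> []" using good_c[OF g] by blast
  let ?l = "h @ cpow c n"
  have lne: "?l \<noteq> []" and llast: "last ?l = last c"
  proof -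
    \<comment> \<open>At least one copy of \<open>c\<close> is present, so the edge into
      \<open>\<rho>\<close> starts at \<open>last c\<close>.\<close>
    obtain m where "n = Suc m" using n(1) by (cases n) auto
    then have "cpow c n = cpow c m @ c"
      unfolding cpow_def by (simp flip: replicate_append_same)
    then show "?l \<noteq> []" "last ?l = last c" using c by auto
  qed
  have play: "(\<rho> k, \<rho> (Suc k)) \<in> edges G" for k
    using n(2)[unfolded is_play_def, rule_format, of "length ?l + k"] by (simp add: lconc_def)
  have seam: "(last c, \<rho> 0) \<in> edges G"
    using n(2)[unfolded is_play_def, rule_format, of "length ?l - 1"] lne llast[symmetric]
    by (simp add: lconc_def last_conv_nth del: append_is_Nil_conv last_append length_append)
  obtain m where m: "\<rho> m = v" using v(1) W by auto
  let ?h = "map \<rho> [0..<Suc m]"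
  have "?h \<in> post_cands G i c W u"
    unfolding post_cands_def is_hist_def
    using play edges_V[OF play] seam W v(2,3) m
    by (auto simp: hd_map last_map nth_append simp del: upt_Suc)
  then obtain h' where "h' \<in> post_cands G i c W u \<and> (\<forall>g. g \<in> post_cands G i c W u \<longrightarrow> length h' \<le> length g)"
    using ex_has_least_nat[of "\<lambda>h. h \<in> post_cands G i c W u" ?h length] by blast
  then have "\<exists>h'. h' \<in> post_cands G i c W u \<and> (\<forall>g\<in>post_cands G i c W u. length h' \<le> length g)"
    by blast
  then show ?thesis unfolding post_seg_def by (rule someI2_ex) blast
qed

text \<open>Only the power of \<open>c\<close> makes a segment long. The final piece depends on
  \<open>c\<close>, \<open>W\<close> and \<open>u\<close> alone and hence takes finitely many
  values.\<close>

lemma segment_bound: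
  obtains B where "\<And>h c W x. good h c W x \<Longrightarrow> length h \<le> B \<and> length c \<le> B"
    "\<And>h c W x u. good h c W x \<Longrightarrow> u \<in> V \<Longrightarrow> length (post_seg G i c W u) \<le> B"
proof -
  let ?F = "(\<lambda>(c, W, u). length (post_seg G i c W u)) ` (lists_V \<times> Pow V \<times> V)"
  have fin: "finite ?F" using finite_V finite_lists_V by auto
  show thesis
  proof (rule that[of "Max (insert (card V) ?F)"])
    fix h c W x assume g: "good h c W x"
    have "card V \<le> Max (insert (card V) ?F)" using fin by simp
    then show "length h \<le> Max (insert (card V) ?F) \<and> length c \<le> Max (insert (card V) ?F)"
      using good_h[OF g] good_c[OF g] unfolding lists_V_def by auto
    fix u assume "u \<in> V"
    then have "length (post_seg G i c W u) \<in> ?F"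
      using good_c[OF g] good_W[OF g] by (intro image_eqI[of _ _ "(c, W, u)"]) auto
    then show "length (post_seg G i c W u) \<le> Max (insert (card V) ?F)" using fin by simp
  qed
qed

section \<open>Legal plays, their rounds and segments\<close>

definition state_ok :: "('v, 'p) rstate \<Rightarrow> bool" where
  "state_ok s = (case s of PSt v \<Rightarrow> v \<in> V | Fam h c W x \<Rightarrow> good h c W x
     | Pre h w \<Rightarrow> w \<in> V | Post c u \<Rightarrow> u \<in> V | _ \<Rightarrow> True)"

lemma state_ok_step: "redge s t \<Longrightarrow> state_ok s \<Longrightarrow> state_ok t"
  unfolding red_edge_def state_ok_def using edges_V by (auto split: rstate.splits)

definition legal :: "(nat \<Rightarrow> ('v, 'p) rstate) \<Rightarrow> bool" where
  "legal \<pi> \<longleftrightarrow> \<pi> 0 = PSt v0 \<and> (\<forall>k. redge (\<pi> k) (\<pi> (Suc k)))"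

lemma legal_ok: "legal \<pi> \<Longrightarrow> state_ok (\<pi> k)"
proof (induction k)
  case 0
  then show ?case using v0 by (simp add: legal_def state_ok_def)
next
  case (Suc k)
  then show ?case using state_ok_step unfolding legal_def by blast
qed

lemma red_hist_ok:
  assumes "red_hist G lam i \<beta> v0 hs" "k < length hs"
  shows "state_ok (hs ! k)"
  using assms(2)
proof (induction k)
  case 0
  then show ?case using assms(1) v0 by (simp add: red_hist_def state_ok_def hd_conv_nth)
next
  case (Suc k)
  then show ?case using state_ok_step assms(1) unfolding red_hist_def by (meson Suc_lessD)
qed

text \<open>Without \<open>Top\<close> and \<open>Bot\<close> the play is forced into a period of
  three: a vertex, a proposed family, a deviation. Round \<open>j\<close> therefore starts at index
  \<open>3 * j\<close>.\<close>

lemma round: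
  assumes "legal \<pi>" and nt: "\<And>k. \<pi> k \<noteq> Top" and nb: "\<And>k. \<pi> k \<noteq> Bot"
  obtains v h c W x u where "\<pi> (3 * j) = PSt v" "\<pi> (3 * j + 1) = Fam h c W x" "good h c W x"
    "hd h = v" "\<pi> (3 * Suc j) = PSt u" "u \<in> V" "redge (Fam h c W x) (\<pi> (3 * j + 2))"
    "(\<exists>h' s. \<pi> (3 * j + 2) = Pre h' u \<and> h' \<noteq> [] \<and> h @ c = h' @ s)
      \<or> (\<pi> (3 * j + 2) = Post c u \<and> (\<exists>v'\<in>W. owner G v' = i \<and> (v', u) \<in> edges G))"
proof -
  have edge: "redge (\<pi> k) (\<pi> (Suc k))" for k using assms(1) by (simp add: legal_def)
  have main: "\<exists>h c W x u. \<pi> (3 * j + 1) = Fam h c W x \<and> good h c W x \<and>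
    hd h = v \<and> \<pi> (3 * Suc j) = PSt u \<and> u \<in> V \<and> redge (Fam h c W x) (\<pi> (3 * j + 2)) \<and>
    ((\<exists>h' s. \<pi> (3 * j + 2) = Pre h' u \<and> h' \<noteq> [] \<and> h @ c = h' @ s)
      \<or> (\<pi> (3 * j + 2) = Post c u \<and> (\<exists>v'\<in>W. owner G v' = i \<and> (v', u) \<in> edges G)))"
    if v: "\<pi> (3 * j) = PSt v" for j v
  proof -
    obtain h c W x where F: "\<pi> (3 * j + 1) = Fam h c W x" "good h c W x" "hd h = v"
      using edge[of "3 * j"] v nb[of "3 * j + 1"] by (auto simp: red_edge_def)
    have e1: "redge (Fam h c W x) (\<pi> (3 * j + 2))"
      using edge[of "3 * j + 1"] F by simp
    have e2: "redge (\<pi> (3 * j + 2)) (\<pi> (3 * Suc j))"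
      using edge[of "3 * j + 2"] by (simp add: eval_nat_numeral)
    have "state_ok (\<pi> (3 * Suc j))" using legal_ok assms(1) by blast
    then show ?thesis using F e1 e2 nt[of "3 * j + 2"]
      unfolding red_edge_def[of _ _ _ _ "Fam h c W x"] by (auto simp: red_edge_def state_ok_def)
  qed
  have "\<exists>v. \<pi> (3 * j) = PSt v" for j
  proof (induction j)
    case 0
    then show ?case using assms(1) by (simp add: legal_def)
  next
    case (Suc j)
    then show ?case using main by blast
  qed
  then show thesis using main that by blast
qed

definition pos :: "(nat \<Rightarrow> ('v, 'p) rstate) \<Rightarrow> nat \<Rightarrow> nat" where
  "pos \<pi> j = length (dot_pref G i \<pi> (3 * j))"

text \<open>Only the step from a family to a deviation contributes to the dotted play, and in round
  \<open>j\<close> it arrives at index \<open>3 * j + 2\<close>.\<close>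

definition seg :: "(nat \<Rightarrow> ('v, 'p) rstate) \<Rightarrow> nat \<Rightarrow> 'v list" where
  "seg \<pi> j = dot_seg G i \<pi> (3 * j + 2) (pos \<pi> j)"

context
  fixes \<pi> assumes legal: "legal \<pi>" and nt: "\<And>k. \<pi> k \<noteq> Top" and nb: "\<And>k. \<pi> k \<noteq> Bot"
begin

lemma dot_pref_round: "dot_pref G i \<pi> (3 * Suc j) = dot_pref G i \<pi> (3 * j) @ seg \<pi> j"
proof -
  obtain v h c W x u where r: "\<pi> (3 * j) = PSt v" "\<pi> (3 * j + 1) = Fam h c W x" "good h c W x"
    "hd h = v" "\<pi> (3 * Suc j) = PSt u" "u \<in> V" "redge (Fam h c W x) (\<pi> (3 * j + 2))"
    and o: "(\<exists>h' s. \<pi> (3 * j + 2) = Pre h' u \<and> h' \<noteq> [] \<and> h @ c = h' @ s)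
      \<or> (\<pi> (3 * j + 2) = Post c u \<and> (\<exists>v'\<in>W. owner G v' = i \<and> (v', u) \<in> edges G))"
    by (rule round[OF legal nt nb, of j])
  have "3 * Suc j = Suc (Suc (Suc (3 * j)))" by simp
  moreover have "dot_seg G i \<pi> (Suc (3 * j)) L = []" for L
    using r by (simp add: dot_seg_def)
  moreover have "dot_seg G i \<pi> (Suc (Suc (Suc (3 * j)))) L = []" for L
    using o by (auto simp: dot_seg_def)
  ultimately show ?thesis unfolding seg_def pos_def
    by (simp del: mult_Suc_right)
qed

lemma pos_Suc: "pos \<pi> (Suc j) = pos \<pi> j + length (seg \<pi> j)"
  unfolding pos_def dot_pref_round by simp

lemma dot_play_seg: "k < length (seg \<pi> j) \<Longrightarrow> dot_play G i \<pi> (pos \<pi> j + k) = seg \<pi> j ! k"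
  using dot_play_nth[of \<pi> "pos \<pi> j + k" G i "3 * Suc j", OF nt] unfolding dot_pref_round
  by (simp add: pos_def nth_append)

lemma seg_cases:
  obtains v h c W x u where "\<pi> (3 * j) = PSt v" "\<pi> (3 * j + 1) = Fam h c W x" "good h c W x"
    "hd h = v" "\<pi> (3 * Suc j) = PSt u" "u \<in> V" "redge (Fam h c W x) (\<pi> (3 * j + 2))"
    "(\<exists>h' s. \<pi> (3 * j + 2) = Pre h' u \<and> h' \<noteq> [] \<and> h @ c = h' @ s \<and> seg \<pi> j = h')
      \<or> (\<pi> (3 * j + 2) = Post c u \<and> post_seg G i c W u \<in> post_cands G i c W u \<and>
           seg \<pi> j = h @ cpow c ((pos \<pi> j + length h)\<^sup>2) @ post_seg G i c W u)"
proof -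
  obtain v h c W x u where r: "\<pi> (3 * j) = PSt v" "\<pi> (3 * j + 1) = Fam h c W x" "good h c W x"
    "hd h = v" "\<pi> (3 * Suc j) = PSt u" "u \<in> V" "redge (Fam h c W x) (\<pi> (3 * j + 2))"
    and o: "(\<exists>h' s. \<pi> (3 * j + 2) = Pre h' u \<and> h' \<noteq> [] \<and> h @ c = h' @ s)
      \<or> (\<pi> (3 * j + 2) = Post c u \<and> (\<exists>v'\<in>W. owner G v' = i \<and> (v', u) \<in> edges G))"
    by (rule round[OF legal nt nb, of j])
  show thesis
  proof (rule that[OF r])
    show "(\<exists>h' s. \<pi> (3 * j + 2) = Pre h' u \<and> h' \<noteq> [] \<and> h @ c = h' @ s \<and> seg \<pi> j = h')
      \<or> (\<pi> (3 * j + 2) = Post c u \<and> post_seg G i c W u \<in> post_cands G i c W u \<and>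
           seg \<pi> j = h @ cpow c ((pos \<pi> j + length h)\<^sup>2) @ post_seg G i c W u)"
      using o r(2) post_seg_in[OF r(3)] by (auto simp: seg_def dot_seg_def)
  qed
qed

lemma seg_props: "seg \<pi> j \<noteq> []" "set (seg \<pi> j) \<subseteq> V" "\<pi> (3 * j) = PSt (hd (seg \<pi> j))"
proof -
  obtain v h c W x u where r: "\<pi> (3 * j) = PSt v" "\<pi> (3 * j + 1) = Fam h c W x" "good h c W x"
    "hd h = v" "\<pi> (3 * Suc j) = PSt u" "u \<in> V" "redge (Fam h c W x) (\<pi> (3 * j + 2))"
    and o: "(\<exists>h' s. \<pi> (3 * j + 2) = Pre h' u \<and> h' \<noteq> [] \<and> h @ c = h' @ s \<and> seg \<pi> j = h')
      \<or> (\<pi> (3 * j + 2) = Post c u \<and> post_seg G i c W u \<in> post_cands G i c W u \<and>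
           seg \<pi> j = h @ cpow c ((pos \<pi> j + length h)\<^sup>2) @ post_seg G i c W u)"
    by (rule seg_cases[of j])
  have hc: "h \<noteq> []" "set h \<subseteq> V" "c \<noteq> []" "set c \<subseteq> V"
    using good_h[OF r(3)] good_c[OF r(3)] by (auto simp: lists_V_def)
  have "seg \<pi> j \<noteq> [] \<and> set (seg \<pi> j) \<subseteq> V \<and> hd (seg \<pi> j) = hd h"
    using o
  proof
    assume "\<exists>h' s. \<pi> (3 * j + 2) = Pre h' u \<and> h' \<noteq> [] \<and> h @ c = h' @ s \<and> seg \<pi> j = h'"
    then obtain s where s: "seg \<pi> j \<noteq> []" "h @ c = seg \<pi> j @ s" by blast
    have "set (seg \<pi> j) \<subseteq> set (h @ c)" "hd (seg \<pi> j) = hd (h @ c)" using s(1) unfolding s(2) by auto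
    then show ?thesis using s(1) hc by auto
  next
    assume P: "\<pi> (3 * j + 2) = Post c u \<and> post_seg G i c W u \<in> post_cands G i c W u \<and>
           seg \<pi> j = h @ cpow c ((pos \<pi> j + length h)\<^sup>2) @ post_seg G i c W u"
    have "set (cpow c n) \<subseteq> set c" for n by (auto simp: cpow_def)
    then have "set (cpow c n) \<subseteq> V" for n using hc(4) by blast
    moreover have "set (post_seg G i c W u) \<subseteq> V"
      using P unfolding post_cands_def is_hist_def by blast
    ultimately show ?thesis using P hc by simp
  qed
  then show "seg \<pi> j \<noteq> []" "set (seg \<pi> j) \<subseteq> V" "\<pi> (3 * j) = PSt (hd (seg \<pi> j))" using r by auto
qed

lemma pos_strict_mono: "strict_mono (pos \<pi>)"
  unfolding strict_mono_Suc_iff pos_Suc using seg_props(1) by auto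

lemma pos_locate: obtains j where "pos \<pi> j \<le> n" "n < pos \<pi> (Suc j)"
proof -
  have "n < pos \<pi> (Suc n)" using seq_suble[OF pos_strict_mono, of "Suc n"] by simp
  then have ex: "\<exists>j. n < pos \<pi> j" by blast
  define j where "j = (LEAST j. n < pos \<pi> j)"
  have j: "n < pos \<pi> j" unfolding j_def using ex by (rule LeastI_ex)
  have "pos \<pi> 0 = 0" by (simp add: pos_def)
  then obtain j' where j': "j = Suc j'" using j by (cases j) auto
  have "\<not> n < pos \<pi> j'" using not_less_Least[of j' "\<lambda>j. n < pos \<pi> j"] j' j_def by simp
  then show thesis using that[of j'] j j' by simp
qed

lemma dot_play_V: "dot_play G i \<pi> n \<in> V"
proof -
  obtain j where j: "pos \<pi> j \<le> n" "n < pos \<pi> (Suc j)" by (rule pos_locate)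
  then have "dot_play G i \<pi> n = seg \<pi> j ! (n - pos \<pi> j)"
    using dot_play_seg[of "n - pos \<pi> j" j] pos_Suc by simp
  moreover have "seg \<pi> j ! (n - pos \<pi> j) \<in> set (seg \<pi> j)"
    using j pos_Suc by simp
  ultimately show ?thesis using seg_props(2) by auto
qed

lemma dot_play_pos: "\<pi> (3 * j) = PSt v \<Longrightarrow> dot_play G i \<pi> (pos \<pi> j) = v"
  using dot_play_seg[of 0 j] seg_props(1,3)[of j] by (simp add: hd_conv_nth)

lemma psum_pre:
  assumes "\<pi> (3 * j + 2) = Pre h' u"
  shows "psum g (dot_play G i \<pi>) (pos \<pi> (Suc j)) = psum g (dot_play G i \<pi>) (pos \<pi> j) + pre_weight g h' u"
proof -
  have s: "seg \<pi> j = h'" "\<pi> (3 * Suc j) = PSt u"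
    by (rule seg_cases[of j]; use assms in auto)+
  \<comment> \<open>The case \<open>k = length h'\<close> reads the first vertex of the next
    segment, which is \<open>u\<close>.\<close>
  have "dot_play G i \<pi> (pos \<pi> j + k) = (h' @ [u]) ! k" if "k \<le> length h'" for k
  proof (cases "k = length h'")
    case True
    then show ?thesis using dot_play_pos[OF s(2)] pos_Suc s(1) by simp
  next
    case False
    then show ?thesis using dot_play_seg[of k j] s(1) that by (simp add: nth_append)
  qed
  from psum_history[of h' "dot_play G i \<pi>" "pos \<pi> j", OF this] show ?thesis
    using pos_Suc s(1) by simp
qed

text \<open>The vertex following the last copy of \<open>c\<close> need not be \<open>hd c\<close>, so only \<open>N\<^sup>2 - 1\<close> turns
  of the cycle contribute exactly its weight.\<close>

lemma psum_post:
  assumes F: "\<pi> (3 * j + 1) = Fam h c W x" and P: "\<pi> (3 * j + 2) = Post c' u"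
    and N: "N = pos \<pi> j + length h" and m: "m < N\<^sup>2"
  shows "psum g (dot_play G i \<pi>) (N + m * length c) = psum g (dot_play G i \<pi>) N + real m * cycle_weight g c"
proof -
  have s: "seg \<pi> j = h @ cpow c (N\<^sup>2) @ post_seg G i c W u" "good h c W x"
  proof -
    obtain v h1 c1 W1 x1 u1 where "\<pi> (3 * j) = PSt v" and F1: "\<pi> (3 * j + 1) = Fam h1 c1 W1 x1"
      and g: "good h1 c1 W1 x1" and
      "hd h1 = v" "\<pi> (3 * Suc j) = PSt u1" "u1 \<in> V" "redge (Fam h1 c1 W1 x1) (\<pi> (3 * j + 2))"
      and o: "(\<exists>h' s. \<pi> (3 * j + 2) = Pre h' u1 \<and> h' \<noteq> [] \<and> h1 @ c1 = h' @ s \<and> seg \<pi> j = h')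
      \<or> (\<pi> (3 * j + 2) = Post c1 u1 \<and> post_seg G i c1 W1 u1 \<in> post_cands G i c1 W1 u1 \<and>
           seg \<pi> j = h1 @ cpow c1 ((pos \<pi> j + length h1)\<^sup>2) @ post_seg G i c1 W1 u1)"
      by (rule seg_cases[of j])
    have "h1 = h" "c1 = c" "W1 = W" "x1 = x" using F F1 by auto
    then show "seg \<pi> j = h @ cpow c (N\<^sup>2) @ post_seg G i c W u" "good h c W x"
      using o P g unfolding N by auto
  qed
  have c: "c \<noteq> []" using good_c[OF s(2)] by blast
  show ?thesis
  proof (rule psum_cycle[OF c])
    fix q assume q: "q \<le> m * length c"
    also have "m * length c < N\<^sup>2 * length c" using m c by simp
    finally have q': "q < N\<^sup>2 * length c" .
    then have "dot_play G i \<pi> (pos \<pi> j + (length h + q)) = seg \<pi> j ! (length h + q)"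
      using s(1) by (intro dot_play_seg) simp
    also have "\<dots> = c ! (q mod length c)"
      using q' by (simp add: s(1) nth_append nth_cpow)
    finally show "dot_play G i \<pi> (N + q) = c ! (q mod length c)" by (simp add: N add.assoc)
  qed
qed

end

section \<open>Bounds on the payoff\<close>

lemma legal_Top: "legal \<pi> \<Longrightarrow> \<pi> k = Top \<Longrightarrow> k \<le> m \<Longrightarrow> \<pi> m = Top"
  by (rotate_tac 2, induction m rule: dec_induct) (auto simp: legal_def red_edge_def split: rstate.splits)

lemma legal_Bot: "legal \<pi> \<Longrightarrow> \<pi> k = Bot \<Longrightarrow> k \<le> m \<Longrightarrow> \<pi> m = Bot"
  by (rotate_tac 2, induction m rule: dec_induct) (auto simp: legal_def red_edge_def split: rstate.splits)

text \<open>After acceptance the dotted play is a finite prefix followed by a play with payoff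
  vector \<open>x\<close>, so prefix independence gives the value.\<close>

lemma nu_Top:
  assumes legal: "legal \<pi>" and top: "\<pi> k = Top"
  obtains j h c W x where "\<pi> j = Fam h c W x" "\<pi> (Suc j) = Top" "nu_C G i \<pi> = ereal (x i)"
proof -
  \<comment> \<open>\<open>dot_play\<close> inspects the predecessor of the first
    \<open>Top\<close>; a later \<open>Top\<close> would have \<open>Top\<close> itself as
    predecessor.\<close>
  define k0 where "k0 = (LEAST k. \<pi> k = Top)"
  have k0: "\<pi> k0 = Top" unfolding k0_def using top by (rule LeastI)
  then obtain j where j: "k0 = Suc j" using legal by (cases k0) (auto simp: legal_def)
  have "\<pi> j \<noteq> Top" using not_less_Least[of j "\<lambda>k. \<pi> k = Top"] j k0_def by simp
  moreover have "redge (\<pi> j) Top" using legal k0 unfolding j legal_def by metis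
  ultimately obtain h c W x where F: "\<pi> j = Fam h c W x"
    unfolding red_edge_def by (auto split: rstate.splits)
  then have "good h c W x" using legal_ok[OF legal, of j] by (simp add: state_ok_def)
  then have ex: "\<exists>\<rho>. is_play G \<rho> \<and> (\<forall>j. mp G j \<rho> = ereal (x j)) \<and> range \<rho> = W"
    unfolding good_family_def punish_family_def by blast
  define \<rho> where "\<rho> = (SOME \<rho>. is_play G \<rho> \<and> (\<forall>j. mp G j \<rho> = ereal (x j)) \<and> range \<rho> = W)"
  have "mp G i \<rho> = ereal (x i)" unfolding \<rho>_def using someI_ex[OF ex] by blast
  moreover have "\<exists>l. dot_play G i \<pi> = lconc l \<rho>"
  proof -
    have "\<exists>k. \<pi> k = Top" using top by blast
    then show ?thesis
      unfolding dot_play_def k0_def[symmetric] j by (simp add: F Let_def \<rho>_def[symmetric]) blast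
  qed
  ultimately have "mp G i (dot_play G i \<pi>) = ereal (x i)" using mp_lconc by metis
  \<comment> \<open>Both sinks are absorbing, so no play visits both.\<close>
  moreover have "\<pi> m \<noteq> Bot" for m
    using legal_Top[OF legal k0, of "max m k0"] legal_Bot[OF legal, of m "max m k0"] by fastforce
  ultimately have "nu_C G i \<pi> = ereal (x i)" by (simp add: nu_C_def)
  then show thesis using that F k0 j by blast
qed

definition gain :: "real \<Rightarrow> 'v \<times> 'v \<Rightarrow> real" where
  "gain \<alpha> e = rew G i e - \<alpha>"

lemma gain_bound: obtains D where "D > 0" "\<And>a b. a \<in> V \<Longrightarrow> b \<in> V \<Longrightarrow> \<bar>gain \<alpha> (a, b)\<bar> \<le> D"
\<comment> \<open>The inserted \<open>1\<close> keeps the bound positive even if all gains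
  vanish.\<close>
proof (rule that[of "Max (insert 1 ((\<lambda>e. \<bar>gain \<alpha> e\<bar>) ` (V \<times> V)))"])
  have fin: "finite (insert 1 ((\<lambda>e. \<bar>gain \<alpha> e\<bar>) ` (V \<times> V)))" using finite_V by simp
  show "0 < Max (insert 1 ((\<lambda>e. \<bar>gain \<alpha> e\<bar>) ` (V \<times> V)))"
    by (rule less_le_trans[OF zero_less_one]) (rule Max_ge[OF fin], simp)
  show "\<bar>gain \<alpha> (a, b)\<bar> \<le> Max (insert 1 ((\<lambda>e. \<bar>gain \<alpha> e\<bar>) ` (V \<times> V)))" if "a \<in> V" "b \<in> V" for a b
    by (rule Max_ge[OF fin]) (use that in blast)
qed

context
  fixes \<pi> assumes legal: "legal \<pi>" and nt: "\<And>k. \<pi> k \<noteq> Top" and nb: "\<And>k. \<pi> k \<noteq> Bot"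
begin

abbreviation "T \<alpha> \<equiv> psum (gain \<alpha>) (dot_play G i \<pi>)"

lemma nu_C_rounds: "nu_C G i \<pi> = mp G i (dot_play G i \<pi>)"
  using nb by (simp add: nu_C_def)

lemma nu_le_rounds:
  assumes "\<And>\<epsilon> M. \<epsilon> > 0 \<Longrightarrow> \<exists>n\<ge>M. T \<alpha> n \<le> \<epsilon> * real n"
  shows "nu_C G i \<pi> \<le> ereal \<alpha>"
  unfolding nu_C_rounds
proof (rule mp_le)
  fix \<epsilon> :: real assume "\<epsilon> > 0"
  then show "\<exists>\<^sub>F n in sequentially. psum (\<lambda>e. rew G i e - \<alpha>) (dot_play G i \<pi>) n \<le> \<epsilon> * real n"
    using assms[of \<epsilon>] unfolding frequently_def eventually_sequentially gain_def by auto
qed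

lemma pos_ge: "j \<le> pos \<pi> j"
  using seq_suble[OF pos_strict_mono[OF legal nt nb]] .

lemma pos_mono: "j \<le> j' \<Longrightarrow> pos \<pi> j \<le> pos \<pi> j'"
  using strict_mono_mono[OF pos_strict_mono[OF legal nt nb]] by (rule monoD)

lemma T_lipschitz:
  assumes "\<And>a b. a \<in> V \<Longrightarrow> b \<in> V \<Longrightarrow> \<bar>gain \<alpha> (a, b)\<bar> \<le> D" and "m \<le> n"
  shows "\<bar>T \<alpha> n - T \<alpha> m\<bar> \<le> D * (real n - real m)"
proof -
  obtain d where d: "n = m + d" using assms(2) le_Suc_ex by blast
  have "\<bar>T \<alpha> (m + d) - T \<alpha> m\<bar> \<le> D * real d"
    by (rule psum_abs_le) (intro assms(1) dot_play_V legal nt nb)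
  then show ?thesis by (simp add: d)
qed

text \<open>At time \<open>N\<close> the gain is at most \<open>D * N\<close>. The cheap cycle is
  then turned \<open>N\<^sup>2 - 1\<close> times, which adds nothing positive but raises the time to
  at least \<open>N\<^sup>2\<close>, so the mean gain is at most \<open>D / N\<close>.\<close>

lemma nu_le_bad_posts:
  assumes bad: "\<And>M. \<exists>j\<ge>M. \<exists>c u. \<pi> (3 * j + 2) = Post c u \<and> cycle_weight (gain \<alpha>) c \<le> 0"
  shows "nu_C G i \<pi> \<le> ereal \<alpha>"
proof (rule nu_le_rounds)
  fix \<epsilon> :: real and M :: nat assume e: "\<epsilon> > 0"
  obtain D where D: "D > 0" "\<And>a b. a \<in> V \<Longrightarrow> b \<in> V \<Longrightarrow> \<bar>gain \<alpha> (a, b)\<bar> \<le> D"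
    using gain_bound[of \<alpha>] by blast
  obtain j c u where j: "max M (nat \<lceil>D / \<epsilon>\<rceil>) \<le> j" and P: "\<pi> (3 * j + 2) = Post c u"
    and c: "cycle_weight (gain \<alpha>) c \<le> 0"
    using bad by blast
  obtain v h c1 W x u1 where "\<pi> (3 * j) = PSt v" and F: "\<pi> (3 * j + 1) = Fam h c1 W x"
    and g: "good h c1 W x" and "hd h = v" "\<pi> (3 * Suc j) = PSt u1" "u1 \<in> V"
    "redge (Fam h c1 W x) (\<pi> (3 * j + 2))" and
    o: "(\<exists>h' s. \<pi> (3 * j + 2) = Pre h' u1 \<and> h' \<noteq> [] \<and> h @ c1 = h' @ s)
      \<or> (\<pi> (3 * j + 2) = Post c1 u1 \<and> (\<exists>v'\<in>W. owner G v' = i \<and> (v', u1) \<in> edges G))"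
    by (rule round[OF legal nt nb])
  have c1: "c1 = c" using o P by auto
  define N where "N = pos \<pi> j + length h"
  define n where "n = N + (N\<^sup>2 - 1) * length c"
  have h: "h \<noteq> []" and cne: "c \<noteq> []" using good_h[OF g] good_c[OF g] c1 by auto
  have jN: "j \<le> N" "1 \<le> N" using pos_ge[of j] h unfolding N_def by (auto simp: Suc_le_eq)
  have N2: "1 \<le> N\<^sup>2" using jN(2) by simp
  have "(N\<^sup>2 - 1) * 1 \<le> (N\<^sup>2 - 1) * length c" using cne by (intro mult_le_mono) (auto simp: Suc_le_eq)
  then have nN: "N\<^sup>2 \<le> n" using jN(2) N2 unfolding n_def by linarith
  have "T \<alpha> n = T \<alpha> N + real (N\<^sup>2 - 1) * cycle_weight (gain \<alpha>) c"
    unfolding n_def using psum_post[OF legal nt nb F[unfolded c1] P N_def, of "N\<^sup>2 - 1"] N2 by simp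
  also have "\<dots> \<le> T \<alpha> N" using c by (simp add: mult_nonneg_nonpos)
  also have "T \<alpha> N \<le> D * real N" using T_lipschitz[of \<alpha> D 0 N, OF D(2)] by (simp add: psum_def)
  also have "\<dots> \<le> \<epsilon> * real N * real N"
  proof (rule mult_right_mono)
    have "D / \<epsilon> \<le> real N" using j jN(1) by linarith
    then show "D \<le> \<epsilon> * real N" using e by (simp add: field_simps)
  qed simp
  also have "\<dots> = \<epsilon> * real (N\<^sup>2)" by (simp add: power2_eq_square)
  also have "\<dots> \<le> \<epsilon> * real n" using nN e by (intro mult_left_mono) auto
  finally have "T \<alpha> n \<le> \<epsilon> * real n" .
  moreover have "N \<le> n" unfolding n_def by simp
  ultimately show "\<exists>n\<ge>M. T \<alpha> n \<le> \<epsilon> * real n" using j jN(1) by (intro exI[of _ n]) auto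
qed

text \<open>A bounded gain at the infinitely many round starts is sublinear there, which is all that
  an upper bound on a limit inferior asks for.\<close>

lemma nu_le_bounded_gain:
  assumes "\<And>j. J \<le> j \<Longrightarrow> T \<alpha> (pos \<pi> j) \<le> C"
  shows "nu_C G i \<pi> \<le> ereal \<alpha>"
proof (rule nu_le_rounds)
  fix \<epsilon> :: real and M :: nat assume e: "\<epsilon> > 0"
  define j where "j = max M (max J (nat \<lceil>C / \<epsilon>\<rceil>))"
  have j: "M \<le> j" "J \<le> j" "C / \<epsilon> \<le> real j" unfolding j_def by linarith+
  have "T \<alpha> (pos \<pi> j) \<le> C" using assms j(2) by blast
  also have "C \<le> \<epsilon> * real j" using j(3) e by (simp add: field_simps)
  also have "\<dots> \<le> \<epsilon> * real (pos \<pi> j)" using pos_ge[of j] e by simp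
  finally show "\<exists>n\<ge>M. T \<alpha> n \<le> \<epsilon> * real n"
    using j(1) pos_ge[of j] by (intro exI[of _ "pos \<pi> j"]) auto
qed

text \<open>Complete turns of a cycle of nonnegative weight lose nothing. What remains are at most
  \<open>3 * B\<close> edges: those of \<open>h\<close>, and then either an unfinished turn or the
  last copy of \<open>c\<close> followed by \<open>post_seg\<close>. A pre-cycle segment is short
  anyway. The loss is thus bounded uniformly in the round.\<close>

lemma segment_gain_ge:
  assumes D: "D > 0" "\<And>a b. a \<in> V \<Longrightarrow> b \<in> V \<Longrightarrow> \<bar>gain \<alpha> (a, b)\<bar> \<le> D"
    and B: "\<And>h c W x. good h c W x \<Longrightarrow> length h \<le> B \<and> length c \<le> B"
      "\<And>h c W x u. good h c W x \<Longrightarrow> u \<in> V \<Longrightarrow> length (post_seg G i c W u) \<le> B"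
    and posts: "\<And>c u. \<pi> (3 * j + 2) = Post c u \<Longrightarrow> 0 \<le> cycle_weight (gain \<alpha>) c"
    and n: "pos \<pi> j \<le> n" "n \<le> pos \<pi> (Suc j)"
  shows "T \<alpha> (pos \<pi> j) - 3 * D * B \<le> T \<alpha> n"
proof -
  obtain v h c W x u where "\<pi> (3 * j) = PSt v" and F: "\<pi> (3 * j + 1) = Fam h c W x"
    and g: "good h c W x" and "hd h = v" "\<pi> (3 * Suc j) = PSt u" and u: "u \<in> V"
    and "redge (Fam h c W x) (\<pi> (3 * j + 2))" and
    o: "(\<exists>h' s. \<pi> (3 * j + 2) = Pre h' u \<and> h' \<noteq> [] \<and> h @ c = h' @ s \<and> seg \<pi> j = h')
      \<or> (\<pi> (3 * j + 2) = Post c u \<and> post_seg G i c W u \<in> post_cands G i c W u \<and>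
           seg \<pi> j = h @ cpow c ((pos \<pi> j + length h)\<^sup>2) @ post_seg G i c W u)"
    by (rule seg_cases[OF legal nt nb])
  note pos_Suc = pos_Suc[OF legal nt nb]
  have lip: "T \<alpha> b \<ge> T \<alpha> a - D * real k" if "a \<le> b" "b \<le> a + k" for a b k
  proof -
    have "\<bar>T \<alpha> b - T \<alpha> a\<bar> \<le> D * (real b - real a)" using T_lipschitz[OF D(2) that(1)] by blast
    also have "\<dots> \<le> D * real k" using that(2) D(1) by (intro mult_left_mono) auto
    finally show ?thesis by linarith
  qed
  have DB: "0 \<le> D * real B" using D(1) by simp
  from o show ?thesis
  proof
    assume "\<exists>h' s. \<pi> (3 * j + 2) = Pre h' u \<and> h' \<noteq> [] \<and> h @ c = h' @ s \<and> seg \<pi> j = h'"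
    then obtain s where "h @ c = seg \<pi> j @ s" by blast
    then have "length (seg \<pi> j) \<le> length (h @ c)" by simp
    then have "n \<le> pos \<pi> j + 3 * B" using n(2) B(1)[OF g] pos_Suc[of j] by simp
    from lip[OF n(1) this] show ?thesis by simp
  next
    assume P: "\<pi> (3 * j + 2) = Post c u \<and> post_seg G i c W u \<in> post_cands G i c W u \<and>
           seg \<pi> j = h @ cpow c ((pos \<pi> j + length h)\<^sup>2) @ post_seg G i c W u"
    then have cw: "0 \<le> cycle_weight (gain \<alpha>) c" using posts by blast
    define N where "N = pos \<pi> j + length h"
    have c: "c \<noteq> []" and h: "h \<noteq> []" using good_c[OF g] good_h[OF g] by auto
    have N2: "1 \<le> N\<^sup>2" using h unfolding N_def by (simp add: Suc_le_eq)
    have TN: "T \<alpha> N \<ge> T \<alpha> (pos \<pi> j) - D * real B"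
      using B(1)[OF g] unfolding N_def by (intro lip) auto
    show ?thesis
    proof (cases "n \<le> N")
      case True
      then have "n \<le> pos \<pi> j + B" using B(1)[OF g] unfolding N_def by simp
      from lip[OF n(1) this] show ?thesis using DB by simp
    next
      case False
      \<comment> \<open>The number of complete turns made before \<open>n\<close>, capped because
        \<open>psum_post\<close> does not cover the last copy of \<open>c\<close>.\<close>
      define q where "q = min ((n - N) div length c) (N\<^sup>2 - 1)"
      have "q * length c \<le> (n - N) div length c * length c" unfolding q_def by (intro mult_le_mono) auto
      also have "\<dots> \<le> n - N" by (rule div_times_less_eq_dividend)
      finally have n1: "N + q * length c \<le> n" using False by simp
      have n2: "n \<le> N + q * length c + 2 * B"
      proof (cases "(n - N) div length c \<le> N\<^sup>2 - 1")
        case True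
        then have "q * length c + (n - N) mod length c = n - N" unfolding q_def by simp
        moreover have "(n - N) mod length c < length c" using c by simp
        ultimately show ?thesis using B(1)[OF g] by linarith
      next
        case False
        then have q: "q = N\<^sup>2 - 1" unfolding q_def by simp
        have "n \<le> N + N\<^sup>2 * length c + length (post_seg G i c W u)"
          using n(2) P unfolding pos_Suc N_def by simp
        moreover have "N\<^sup>2 * length c = q * length c + length c"
          using N2 unfolding q by (metis Suc_diff_1 Suc_le_eq One_nat_def mult_Suc add.commute)
        ultimately show ?thesis using B(1)[OF g] B(2)[OF g u] by linarith
      qed
      have "q < N\<^sup>2" using N2 unfolding q_def by linarith
      then have "T \<alpha> (N + q * length c) = T \<alpha> N + real q * cycle_weight (gain \<alpha>) c"
        using P by (intro psum_post[OF legal nt nb F _ N_def]) auto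
      then have "T \<alpha> (N + q * length c) \<ge> T \<alpha> N" using cw by simp
      moreover have "T \<alpha> n \<ge> T \<alpha> (N + q * length c) - D * real (2 * B)" by (rule lip[OF n1 n2])
      ultimately show ?thesis using TN by simp
    qed
  qed
qed

text \<open>This quadratic jump lets a post-cycle deviation outweigh any earlier deficit, which is
  at most linear.\<close>

lemma pos_post:
  assumes "\<pi> (3 * j + 2) = Post c' u'"
  shows "(pos \<pi> j)\<^sup>2 \<le> pos \<pi> (Suc j)"
proof -
  obtain v h c W x u where "\<pi> (3 * j) = PSt v" and F: "\<pi> (3 * j + 1) = Fam h c W x"
    and g: "good h c W x" and "hd h = v" "\<pi> (3 * Suc j) = PSt u" and u: "u \<in> V"
    and "redge (Fam h c W x) (\<pi> (3 * j + 2))" and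
    o: "(\<exists>h' s. \<pi> (3 * j + 2) = Pre h' u \<and> h' \<noteq> [] \<and> h @ c = h' @ s \<and> seg \<pi> j = h')
      \<or> (\<pi> (3 * j + 2) = Post c u \<and> post_seg G i c W u \<in> post_cands G i c W u \<and>
           seg \<pi> j = h @ cpow c ((pos \<pi> j + length h)\<^sup>2) @ post_seg G i c W u)"
    by (rule seg_cases[OF legal nt nb])
  have s: "seg \<pi> j = h @ cpow c ((pos \<pi> j + length h)\<^sup>2) @ post_seg G i c W u"
    using o assms by auto
  have "(pos \<pi> j)\<^sup>2 * 1 \<le> (pos \<pi> j + length h)\<^sup>2 * length c"
    using good_c[OF g] by (intro mult_le_mono power_mono) (auto simp: Suc_le_eq)
  then show ?thesis unfolding pos_Suc[OF legal nt nb] s by simp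
qed

text \<open>\<open>t\<close> is an energy that is reset to \<open>0\<close> at each expensive
  post-cycle deviation. Between resets it changes exactly as the partial sums do; at a reset from
  position \<open>p\<close> the true deficit is at most \<open>D * p\<close> plus a constant, while
  the next position is at least \<open>p\<^sup>2\<close>.\<close>

lemma nu_ge_rounds:
  assumes tK: "\<And>j. J \<le> j \<Longrightarrow> - K \<le> t j"
    and step: "\<And>j. J \<le> j \<Longrightarrow>
      (\<exists>h' u. \<pi> (3 * j + 2) = Pre h' u \<and> t (Suc j) = t j + pre_weight (gain \<alpha>) h' u) \<or>
      (\<exists>c u. \<pi> (3 * j + 2) = Post c u \<and> 0 \<le> cycle_weight (gain \<alpha>) c \<and> t (Suc j) = 0)"
  shows "ereal \<alpha> \<le> nu_C G i \<pi>"
  unfolding nu_C_rounds mp_ge_iff gain_def[symmetric]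
proof (intro allI impI)
  fix \<epsilon>' :: real assume "\<epsilon>' > 0"
  \<comment> \<open>One half pays for the resets, the other for the constants once \<open>n\<close>
    is large.\<close>
  define \<epsilon> where "\<epsilon> = \<epsilon>' / 2"
  have e: "\<epsilon> > 0" using \<open>\<epsilon>' > 0\<close> unfolding \<epsilon>_def by simp
  obtain D where D: "D > 0" "\<And>a b. a \<in> V \<Longrightarrow> b \<in> V \<Longrightarrow> \<bar>gain \<alpha> (a, b)\<bar> \<le> D"
    using gain_bound[of \<alpha>] by blast
  obtain B where B: "\<And>h c W x. good h c W x \<Longrightarrow> length h \<le> B \<and> length c \<le> B"
      "\<And>h c W x u. good h c W x \<Longrightarrow> u \<in> V \<Longrightarrow> length (post_seg G i c W u) \<le> B"
    by (rule segment_bound) blast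
  have seg_ge: "T \<alpha> (pos \<pi> j) - 3 * D * B \<le> T \<alpha> n"
    if "J \<le> j" "pos \<pi> j \<le> n" "n \<le> pos \<pi> (Suc j)" for j n
  proof (rule segment_gain_ge[OF D B _ that(2,3)])
    show "0 \<le> cycle_weight (gain \<alpha>) c" if "\<pi> (3 * j + 2) = Post c u" for c u
      using step[OF \<open>J \<le> j\<close>] that by auto
  qed auto
  \<comment> \<open>The first summand serves the start at \<open>J\<close>, the other two a reset.
    Errors of successive resets do not accumulate, since each reset is estimated afresh from the
    crude bound \<open>- D * p\<close>.\<close>
  define C where "C = \<bar>t J - T \<alpha> (pos \<pi> J)\<bar> + D * D / \<epsilon> + 3 * D * B"
  have CD: "D * D / \<epsilon> + 3 * D * B \<le> C" unfolding C_def by simp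
  have C0: "\<bar>t J - T \<alpha> (pos \<pi> J)\<bar> \<le> C" unfolding C_def using D(1) e by simp
  have main: "t j - \<epsilon> * real (pos \<pi> j) - C \<le> T \<alpha> (pos \<pi> j)" if "J \<le> j" for j
    using that
  proof (induction j rule: dec_induct)
    case base
    have "0 \<le> \<epsilon> * real (pos \<pi> J)" using e by simp
    then show ?case using C0 by linarith
  next
    case (step j)
    show ?case using assms(2)[OF step.hyps(1)]
    proof
      assume "\<exists>h' u. \<pi> (3 * j + 2) = Pre h' u \<and> t (Suc j) = t j + pre_weight (gain \<alpha>) h' u"
      then obtain h' u where P: "\<pi> (3 * j + 2) = Pre h' u" "t (Suc j) = t j + pre_weight (gain \<alpha>) h' u"
        by blast
      have "\<epsilon> * real (pos \<pi> j) \<le> \<epsilon> * real (pos \<pi> (Suc j))"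
        using e pos_mono[of j "Suc j"] by simp
      then show ?thesis using psum_pre[OF legal nt nb P(1), of "gain \<alpha>"] P(2) step.IH by linarith
    next
      assume "\<exists>c u. \<pi> (3 * j + 2) = Post c u \<and> 0 \<le> cycle_weight (gain \<alpha>) c \<and> t (Suc j) = 0"
      then obtain c u where P: "\<pi> (3 * j + 2) = Post c u" "t (Suc j) = 0" by blast
      define p where "p = real (pos \<pi> j)"
      have p0: "0 \<le> p" unfolding p_def by simp
      have "T \<alpha> (pos \<pi> (Suc j)) \<ge> T \<alpha> (pos \<pi> j) - 3 * D * B"
        using pos_mono[of j "Suc j"] by (intro seg_ge[OF step.hyps(1)]) auto
      moreover have "T \<alpha> (pos \<pi> j) \<ge> - D * p"
        using T_lipschitz[of \<alpha> D 0 "pos \<pi> j", OF D(2)] by (simp add: psum_def p_def)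
      \<comment> \<open>Positions up to \<open>D / \<epsilon>\<close> cost a constant, later ones
        are dominated by the square.\<close>
      moreover have "D * p \<le> \<epsilon> * p\<^sup>2 + D * D / \<epsilon>"
      proof (cases "p \<le> D / \<epsilon>")
        case True
        then have "D * p \<le> D * (D / \<epsilon>)" using D(1) by (intro mult_left_mono) auto
        moreover have "0 \<le> \<epsilon> * p\<^sup>2" using e by simp
        ultimately show ?thesis by simp
      next
        case False
        then have "D \<le> \<epsilon> * p" using e by (simp add: field_simps)
        then have "D * p \<le> \<epsilon> * p * p" using p0 by (intro mult_right_mono)
        moreover have "0 \<le> D * D / \<epsilon>" using e by simp
        ultimately show ?thesis by (simp add: power2_eq_square)
      qed
      moreover have "\<epsilon> * p\<^sup>2 \<le> \<epsilon> * real (pos \<pi> (Suc j))"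
      proof (rule mult_left_mono)
        have "real ((pos \<pi> j)\<^sup>2) \<le> real (pos \<pi> (Suc j))"
          using pos_post[OF P(1)] by (simp only: of_nat_le_iff)
        then show "p\<^sup>2 \<le> real (pos \<pi> (Suc j))" by (simp add: p_def)
      qed (use e in simp)
      ultimately show ?thesis using CD P(2) by linarith
    qed
  qed
  define C' where "C' = K + C + 3 * D * B"
  have "eventually (\<lambda>n. C' / \<epsilon> < real n) sequentially"
    using filterlim_at_top_dense filterlim_real_sequentially by blast
  then show "eventually (\<lambda>n. - \<epsilon>' * real n < T \<alpha> n) sequentially"
    using eventually_ge_at_top[of "pos \<pi> J"]
  proof eventually_elim
    case (elim n)
    obtain j where j: "pos \<pi> j \<le> n" "n < pos \<pi> (Suc j)"
      by (rule pos_locate[OF legal nt nb])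
    have J: "J \<le> j" using pos_mono[of "Suc j" J] j elim(2) by (meson not_less_eq_eq not_le order.trans)
    have "T \<alpha> n \<ge> T \<alpha> (pos \<pi> j) - 3 * D * B" using seg_ge[OF J j(1)] j(2) by simp
    moreover have "\<epsilon> * real (pos \<pi> j) \<le> \<epsilon> * real n" using j(1) e by simp
    moreover have "C' < \<epsilon> * real n" using elim(1) e by (simp add: field_simps)
    moreover have "- \<epsilon>' * real n = - \<epsilon> * real n - \<epsilon> * real n" by (simp add: \<epsilon>_def)
    ultimately show ?case using main[OF J] tK[OF J] unfolding C'_def by linarith
  qed
qed

end

section \<open>Strategies and certificates\<close>

abbreviation "pstrat \<equiv> prover_strategy G lam i \<beta> v0"
abbreviation "cstrat \<equiv> challenger_strategy G lam i \<beta> v0"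
abbreviation "guarantee \<equiv> prover_guarantee G lam i \<beta> v0"

section \<open>Plays and histories that follow a strategy\<close>

definition follows :: "('v, 'p) rstrat \<Rightarrow> (nat \<Rightarrow> ('v, 'p) rstate) \<Rightarrow> bool" where
  "follows \<sigma> \<pi> \<longleftrightarrow> (\<forall>k. is_prover_state (\<pi> k) \<longrightarrow> \<pi> (Suc k) = \<sigma> (map \<pi> [0..<Suc k]))"

definition chist :: "('v, 'p) rstrat \<Rightarrow> ('v, 'p) rstate list \<Rightarrow> bool" where
  "chist \<sigma> hs \<longleftrightarrow> red_hist G lam i \<beta> v0 hs \<and>
     (\<forall>k. Suc k < length hs \<longrightarrow> is_prover_state (hs ! k) \<longrightarrow> hs ! Suc k = \<sigma> (take (Suc k) hs))"

lemma chist_start: "chist \<sigma> [PSt v0]"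
  by (simp add: chist_def red_hist_def)

lemma chist_snoc:
  assumes "chist \<sigma> hs" "redge (last hs) s" "is_prover_state (last hs) \<Longrightarrow> s = \<sigma> hs"
  shows "chist \<sigma> (hs @ [s])"
proof -
  have hs: "hs \<noteq> []" using assms(1) by (simp add: chist_def red_hist_def)
  have "redge ((hs @ [s]) ! k) ((hs @ [s]) ! Suc k) \<and>
      (is_prover_state ((hs @ [s]) ! k) \<longrightarrow> (hs @ [s]) ! Suc k = \<sigma> (take (Suc k) (hs @ [s])))"
    if k: "Suc k < length (hs @ [s])" for k
  proof (cases "Suc k < length hs")
    case True
    then show ?thesis using assms(1) by (simp add: chist_def red_hist_def nth_append)
  next
    case False
    then have "Suc k = length hs" using k by simp
    then have "k = length hs - 1" "length hs > 0" by auto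
    then show ?thesis using assms(2,3) hs by (simp add: nth_append last_conv_nth)
  qed
  then show ?thesis using assms(1) hs by (simp add: chist_def red_hist_def)
qed

lemma chist_take: "chist \<sigma> hs \<Longrightarrow> 0 < n \<Longrightarrow> chist \<sigma> (take n hs)"
  by (auto simp: chist_def red_hist_def min_def hd_take)

lemma chist_limit:
  assumes "\<And>n. chist \<sigma> (map \<pi> [0..<Suc n])"
  shows "legal \<pi> \<and> follows \<sigma> \<pi>"
proof -
  have "hd (map \<pi> [0..<Suc 0]) = PSt v0"
    using assms[of 0] unfolding chist_def red_hist_def by blast
  then have "\<pi> 0 = PSt v0" by simp
  moreover have "redge (\<pi> k) (\<pi> (Suc k)) \<and>
      (is_prover_state (\<pi> k) \<longrightarrow> \<pi> (Suc k) = \<sigma> (map \<pi> [0..<Suc k]))" for k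
  proof -
    have *: "map \<pi> [0..<Suc (Suc k)] ! k = \<pi> k" "map \<pi> [0..<Suc (Suc k)] ! Suc k = \<pi> (Suc k)"
      "take (Suc k) (map \<pi> [0..<Suc (Suc k)]) = map \<pi> [0..<Suc k]"
      "Suc k < length (map \<pi> [0..<Suc (Suc k)])"
      by (simp_all add: nth_append take_map del: upt_Suc)
    show ?thesis using assms[of "Suc k"] *(4) unfolding chist_def red_hist_def
      by (metis *(1-3))
  qed
  ultimately show ?thesis by (auto simp: legal_def follows_def simp del: upt_Suc)
qed

text \<open>Payoffs belong to infinite plays; this completes a history that has reached a
  sink.\<close>

lemma chist_sink:
  assumes "chist \<sigma> hs" "last hs = s" "s = Top \<or> s = Bot"
  shows "legal (lconc hs (\<lambda>_. s)) \<and> follows \<sigma> (lconc hs (\<lambda>_. s))"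
proof (rule chist_limit)
  fix n
  have rep: "chist \<sigma> (hs @ replicate m s) \<and> last (hs @ replicate m s) = s" for m
  proof (induction m)
    case (Suc m)
    have "chist \<sigma> ((hs @ replicate m s) @ [s])"
      using Suc assms(3) by (intro chist_snoc) (auto simp: red_edge_def is_prover_state_def)
    then show ?case by (simp add: replicate_append_same)
  qed (use assms in simp)
  have "map (lconc hs (\<lambda>_. s)) [0..<Suc n] = take (Suc n) (hs @ replicate (Suc n) s)"
    by (rule nth_equalityI) (auto simp: lconc_def nth_append simp del: upt_Suc replicate_Suc)
  then show "chist \<sigma> (map (lconc hs (\<lambda>_. s)) [0..<Suc n])"
    using chist_take[of \<sigma> "hs @ replicate (Suc n) s" "Suc n"] rep by (simp only: zero_less_Suc)
qed

lemma out_hist_outcome: "out_hist \<sigma> \<tau> v0 n = map (outcome \<sigma> \<tau> v0) [0..<Suc n]"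
proof (induction n)
  case (Suc n)
  have "out_hist \<sigma> \<tau> v0 (Suc n) = out_hist \<sigma> \<tau> v0 n @ [outcome \<sigma> \<tau> v0 (Suc n)]"
    by (simp add: outcome_def Let_def)
  then show ?case by (simp add: Suc.IH del: out_hist.simps)
qed (simp add: outcome_def)

lemma outcome_legal:
  assumes "pstrat \<sigma>" "cstrat \<tau>"
  shows "legal (outcome \<sigma> \<tau> v0) \<and> follows \<sigma> (outcome \<sigma> \<tau> v0)"
proof (rule chist_limit)
  fix n
  have "chist \<sigma> (out_hist \<sigma> \<tau> v0 n)"
  proof (induction n)
    case 0
    show ?case by (simp add: chist_start)
  next
    case (Suc n)
    let ?hs = "out_hist \<sigma> \<tau> v0 n"
    have "red_hist G lam i \<beta> v0 ?hs" using Suc by (simp add: chist_def)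
    then have "redge (last ?hs) (if is_prover_state (last ?hs) then \<sigma> ?hs else \<tau> ?hs)"
      using assms unfolding prover_strategy_def challenger_strategy_def by simp
    then show ?case unfolding out_hist.simps(2) Let_def by (intro chist_snoc[OF Suc]) auto
  qed
  then show "chist \<sigma> (map (outcome \<sigma> \<tau> v0) [0..<Suc n])" by (simp only: out_hist_outcome)
qed

lemma red_hist_last_ok: "red_hist G lam i \<beta> v0 hs \<Longrightarrow> state_ok (last hs)"
  using red_hist_ok[of hs "length hs - 1"] by (auto simp: red_hist_def last_conv_nth)

text \<open>Challenger reads the next state off the play as long as the history is one of its
  prefixes. Strategies of Challenger can then be replaced by plays.\<close>

lemma realize_play:
  assumes legal: "legal \<pi>" and fol: "follows \<sigma> \<pi>"
  shows "\<exists>\<tau>. cstrat \<tau> \<and> outcome \<sigma> \<tau> v0 = \<pi>"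
proof -
  \<comment> \<open>Off the play any legal move will do; one exists, since a good family can always
    be accepted.\<close>
  define \<tau> where "\<tau> hs = (if \<exists>n. hs = map \<pi> [0..<Suc n] then \<pi> (length hs)
      else (SOME t. redge (last hs) t))" for hs
  have "redge (last hs) (\<tau> hs)" if hs: "red_hist G lam i \<beta> v0 hs" "\<not> is_prover_state (last hs)" for hs
  proof (cases "\<exists>n. hs = map \<pi> [0..<Suc n]")
    case True
    then obtain n where n: "hs = map \<pi> [0..<Suc n]" by blast
    then have "\<tau> hs = \<pi> (Suc n)" "last hs = \<pi> n" by (auto simp: \<tau>_def)
    then show ?thesis using legal by (simp add: legal_def)
  next
    case False
    have "\<exists>t. redge (last hs) t"
      using red_hist_last_ok[OF hs(1)] hs(2)
      by (cases "last hs") (auto simp: red_edge_def state_ok_def is_prover_state_def)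
    then show ?thesis using False unfolding \<tau>_def by (auto intro: someI_ex)
  qed
  then have "cstrat \<tau>" by (simp add: challenger_strategy_def)
  moreover have "out_hist \<sigma> \<tau> v0 n = map \<pi> [0..<Suc n]" for n
  proof (induction n)
    case 0
    then show ?case using legal by (simp add: legal_def)
  next
    case (Suc n)
    have "\<tau> (map \<pi> [0..<Suc n]) = \<pi> (Suc n)" unfolding \<tau>_def by auto
    moreover have "last (map \<pi> [0..<Suc n]) = \<pi> n" by simp
    moreover have "is_prover_state (\<pi> n) \<Longrightarrow> \<sigma> (map \<pi> [0..<Suc n]) = \<pi> (Suc n)"
      using fol by (simp add: follows_def)
    moreover have "map \<pi> [0..<Suc (Suc n)] = map \<pi> [0..<Suc n] @ [\<pi> (Suc n)]" by simp
    ultimately show ?case unfolding out_hist.simps(2) Suc.IH Let_def by presburger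
  qed
  then have "outcome \<sigma> \<tau> v0 = \<pi>" unfolding outcome_def by (simp add: fun_eq_iff)
  ultimately show ?thesis by blast
qed

lemma nu_le_guarantee:
  assumes "legal \<pi>" "follows \<sigma> \<pi>"
  shows "nu_C G i \<pi> \<le> guarantee \<sigma>"
proof -
  obtain \<tau> where "cstrat \<tau>" "outcome \<sigma> \<tau> v0 = \<pi>" using realize_play[OF assms] by blast
  then show ?thesis unfolding prover_guarantee_def by (auto intro!: SUP_upper2[of \<tau>])
qed

section \<open>Memoryless strategies and certificates\<close>

definition mstrat :: "('v \<Rightarrow> ('v, 'p) rstate) \<Rightarrow> ('v, 'p) rstrat" where
  "mstrat s hs = (case last hs of PSt v \<Rightarrow> s v | _ \<Rightarrow> Bot)"

lemma mstrat_strategy: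
  assumes "\<And>v. v \<in> V \<Longrightarrow> redge (PSt v) (s v)"
  shows "pstrat (mstrat s)"
  unfolding prover_strategy_def
proof (intro allI impI)
  fix hs assume hs: "red_hist G lam i \<beta> v0 hs \<and> is_prover_state (last hs)"
  then obtain v where v: "last hs = PSt v" by (auto simp: is_prover_state_def split: rstate.splits)
  then have "v \<in> V" using red_hist_last_ok[of hs] hs by (simp add: state_ok_def)
  then show "redge (last hs) (mstrat s hs)" using assms v by (simp add: mstrat_def)
qed

lemma mstrat_memoryless: "memoryless_prover G lam i \<beta> v0 (mstrat s)"
  by (simp add: memoryless_prover_def mstrat_def)

definition proposals :: "real \<Rightarrow> 'v \<Rightarrow> ('v, 'p) rstate set" where
  "proposals \<alpha> v = {Fam h c W x | h c W x. good h c W x \<and> hd h = v \<and> x i \<le> \<alpha>}"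

lemma finite_families: "finite {Fam h c W x | h c W x. good h c W x}"
proof -
  have "{Fam h c W x | h c W x. good h c W x} = (\<lambda>(h, c, W, x). Fam h c W x) ` {(h, c, W, x). good h c W x}"
    by force
  then show ?thesis using finite_good by simp
qed

lemma finite_proposals: "finite (proposals \<alpha> v)"
  by (rule finite_subset[OF _ finite_families]) (auto simp: proposals_def)

text \<open>A certificate that Prover keeps Challenger's payoff at most \<open>\<alpha>\<close>: the rank \<open>rk\<close> drops at each
  post-cycle deviation whose punishing cycle has mean at least \<open>\<alpha>\<close>, post-cycle deviations
  with a cheaper cycle may lead anywhere in \<open>Z\<close>, and along the remaining pre-cycle
  deviations the potential \<open>f\<close> pays for the gain above \<open>\<alpha>\<close>.\<close>

definition certified ::
  "real \<Rightarrow> 'v set \<Rightarrow> 'v set \<Rightarrow> ('v \<Rightarrow> ('v, 'p) rstate) \<Rightarrow> ('v \<Rightarrow> nat) \<Rightarrow> ('v \<Rightarrow> real) \<Rightarrow> bool" where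
  "certified \<alpha> Z Y act rk f \<longleftrightarrow> Y \<subseteq> V \<and> (\<forall>v\<in>Y. 0 \<le> f v \<and> act v \<in> proposals \<alpha> v \<and>
     (\<forall>h' u. redge (act v) (Pre h' u) \<longrightarrow> u \<in> Y \<and>
        (rk u < rk v \<or> rk u = rk v \<and> f u \<le> f v - pre_weight (gain \<alpha>) h' u)) \<and>
     (\<forall>c u. redge (act v) (Post c u) \<longrightarrow>
        (if 0 \<le> cycle_weight (gain \<alpha>) c then u \<in> Y \<and> rk u < rk v else u \<in> Z)))"

text \<open>With \<open>Z = Y\<close> the play never visits a vertex outside \<open>Y\<close>. If
  cheap cycles recur forever, \<open>nu_le_bad_posts\<close> applies. Otherwise the rank eventually
  stops decreasing, only pre-cycle deviations at constant rank remain, and the potential bounds the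
  gain.\<close>

lemma certified_bound:
  assumes cert: "certified \<alpha> Y Y act rk f" and v0: "v0 \<in> Y" and legal: "legal \<pi>"
    and act: "\<And>k v. \<pi> k = PSt v \<Longrightarrow> v \<in> Y \<Longrightarrow> \<pi> (Suc k) = act v"
  shows "nu_C G i \<pi> \<le> ereal \<alpha>"
proof -
  have edge: "redge (\<pi> k) (\<pi> (Suc k))" for k using legal by (simp add: legal_def)
  have f_nonneg: "0 \<le> f v" if "v \<in> Y" for v
    using cert that unfolding certified_def by blast
  have prp: "act v \<in> proposals \<alpha> v" if "v \<in> Y" for v
    using cert that unfolding certified_def by blast
  have pre: "u \<in> Y \<and> (rk u < rk v \<or> rk u = rk v \<and> f u \<le> f v - pre_weight (gain \<alpha>) h' u)"
    if "v \<in> Y" "redge (act v) (Pre h' u)" for v h' u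
    using cert that unfolding certified_def by blast
  have post: "u \<in> Y \<and> (0 \<le> cycle_weight (gain \<alpha>) c \<longrightarrow> rk u < rk v)"
    if "v \<in> Y" "redge (act v) (Post c u)" for v c u
    using cert that unfolding certified_def by meson
  define inv where "inv s \<longleftrightarrow> (case s of PSt v \<Rightarrow> v \<in> Y | Fam _ _ _ _ \<Rightarrow> \<exists>v\<in>Y. s = act v
     | Pre _ u \<Rightarrow> u \<in> Y | Post _ u \<Rightarrow> u \<in> Y | Top \<Rightarrow> True | Bot \<Rightarrow> False)" for s
  have inv: "inv (\<pi> k)" for k
  proof (induction k)
    case 0
    then show ?case using legal v0 by (simp add: legal_def inv_def)
  next
    case (Suc k)
    show ?case
    proof (cases "\<pi> k")
      case (PSt v)
      then have v: "v \<in> Y" using Suc by (simp add: inv_def)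
      then show ?thesis using act[OF PSt v] prp[OF v] by (force simp: inv_def proposals_def)
    next
      case (Fam h c W x)
      then obtain v where v: "v \<in> Y" "\<pi> k = act v" using Suc by (auto simp: inv_def)
      then have e: "redge (act v) (\<pi> (Suc k))" using edge[of k] by simp
      consider "\<pi> (Suc k) = Top" | h' u where "\<pi> (Suc k) = Pre h' u" | u where "\<pi> (Suc k) = Post c u"
        using edge[of k] unfolding Fam red_edge_def by auto
      then show ?thesis
        by cases (use pre[OF v(1)] post[OF v(1)] e in \<open>auto simp: inv_def\<close>)
    qed (use Suc edge[of k] in \<open>auto simp: inv_def red_edge_def\<close>)
  qed
  have nb: "\<pi> k \<noteq> Bot" for k using inv[of k] by (auto simp: inv_def)
  show ?thesis
  proof (cases "\<exists>k. \<pi> k = Top")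
    case True
    then obtain j h c W x where j: "\<pi> j = Fam h c W x" "nu_C G i \<pi> = ereal (x i)"
      using nu_Top[OF legal] by metis
    then obtain v where "v \<in> Y" "Fam h c W x = act v" using inv[of j] by (auto simp: inv_def)
    then have "x i \<le> \<alpha>" using prp[of v] by (auto simp: proposals_def)
    then show ?thesis using j(2) by simp
  next
    case False
    then have nt: "\<pi> k \<noteq> Top" for k by blast
    define vs where "vs j = (case \<pi> (3 * j) of PSt v \<Rightarrow> v | _ \<Rightarrow> undefined)" for j
    \<comment> \<open>Cycles of weight \<open>0\<close> are put on the cheap side here, while
      \<open>certified\<close> treats them as expensive; both estimates apply to them.\<close>
    let ?bad = "\<lambda>j. \<exists>c u. \<pi> (3 * j + 2) = Post c u \<and> cycle_weight (gain \<alpha>) c \<le> 0"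
    show ?thesis
    proof (cases "\<forall>M. \<exists>j\<ge>M. ?bad j")
      case True
      then show ?thesis using nu_le_bad_posts[OF legal nt nb] by blast
    next
      case False
      then obtain M where M: "\<And>j. M \<le> j \<Longrightarrow> \<not> ?bad j" by blast
      have rstep: "vs j \<in> Y \<and> (rk (vs (Suc j)) < rk (vs j) \<or> (\<exists>h' u. \<pi> (3 * j + 2) = Pre h' u \<and>
          rk (vs (Suc j)) = rk (vs j) \<and> f (vs (Suc j)) \<le> f (vs j) - pre_weight (gain \<alpha>) h' u))"
        if "M \<le> j" for j
      proof -
        obtain v h c W x u where r: "\<pi> (3 * j) = PSt v" "\<pi> (3 * j + 1) = Fam h c W x" "good h c W x"
          "hd h = v" "\<pi> (3 * Suc j) = PSt u" "u \<in> V" "redge (Fam h c W x) (\<pi> (3 * j + 2))"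
          and o: "(\<exists>h' s. \<pi> (3 * j + 2) = Pre h' u \<and> h' \<noteq> [] \<and> h @ c = h' @ s)
            \<or> (\<pi> (3 * j + 2) = Post c u \<and> (\<exists>v'\<in>W. owner G v' = i \<and> (v', u) \<in> edges G))"
          by (rule round[OF legal nt nb, of j])
        have vs: "vs j = v" "vs (Suc j) = u" unfolding vs_def r by simp_all
        have v: "v \<in> Y" using inv[of "3 * j"] r(1) by (simp add: inv_def)
        then have "act v = Fam h c W x" using act[OF r(1)] r(2) by simp
        then have e: "redge (act v) (\<pi> (3 * j + 2))" using r(7) by simp
        from o show ?thesis
        proof
          assume "\<exists>h' s. \<pi> (3 * j + 2) = Pre h' u \<and> h' \<noteq> [] \<and> h @ c = h' @ s"
          then obtain h' where h': "\<pi> (3 * j + 2) = Pre h' u" by blast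
          then show ?thesis using pre[OF v, of h' u] e v unfolding vs by auto
        next
          assume P: "\<pi> (3 * j + 2) = Post c u \<and> (\<exists>v'\<in>W. owner G v' = i \<and> (v', u) \<in> edges G)"
          then have "0 \<le> cycle_weight (gain \<alpha>) c" using M[OF that] by force
          then show ?thesis using post[OF v, of c u] e P v unfolding vs by auto
        qed
      qed
      \<comment> \<open>From round \<open>M\<close> on ranks never increase, so the rank is constant
        once its least value is reached.\<close>
      define r where "r = (LEAST r. \<exists>j\<ge>M. rk (vs j) = r)"
      have "\<exists>r. \<exists>j\<ge>M. rk (vs j) = r" by blast
      then have "\<exists>j\<ge>M. rk (vs j) = r" unfolding r_def by (rule LeastI_ex)
      then obtain J where J: "M \<le> J" "rk (vs J) = r" by blast
      have r_le: "r \<le> rk (vs j)" if "M \<le> j" for j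
        unfolding r_def using that by (intro Least_le) blast
      have rk: "rk (vs j) = r" if "J \<le> j" for j
        using that
      proof (induction j rule: dec_induct)
        case (step j)
        then show ?case using rstep[of j] r_le[of "Suc j"] J(1) by fastforce
      qed (rule J(2))
      have main: "T \<pi> \<alpha> (pos \<pi> j) + f (vs j) \<le> T \<pi> \<alpha> (pos \<pi> J) + f (vs J)" if "J \<le> j" for j
        using that
      proof (induction j rule: dec_induct)
        case (step j)
        obtain h' u where "\<pi> (3 * j + 2) = Pre h' u"
          "f (vs (Suc j)) \<le> f (vs j) - pre_weight (gain \<alpha>) h' u"
          using rstep[of j] rk[of j] rk[of "Suc j"] step.hyps J(1) by force
        then show ?case using step.IH psum_pre[OF legal nt nb, of j h' u "gain \<alpha>"] by simp
      qed simp
      show ?thesis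
      proof (rule nu_le_bounded_gain[OF legal nt nb])
        fix j assume j: "J \<le> j"
        have "0 \<le> f (vs j)" using rstep[of j] J(1) j f_nonneg[of "vs j"] by simp
        then show "T \<pi> \<alpha> (pos \<pi> j) \<le> T \<pi> \<alpha> (pos \<pi> J) + f (vs J)" using main[OF j] by simp
      qed
    qed
  qed
qed

section \<open>From a good strategy to a certificate\<close>

lemma pre_weight_bound:
  obtains C where "\<And>h c W x h' u. good h c W x \<Longrightarrow> redge (Fam h c W x) (Pre h' u) \<Longrightarrow>
    \<bar>pre_weight (gain \<alpha>) h' u\<bar> \<le> C"
proof -
  obtain D where D: "D > 0" "\<And>a b. a \<in> V \<Longrightarrow> b \<in> V \<Longrightarrow> \<bar>gain \<alpha> (a, b)\<bar> \<le> D"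
    using gain_bound[of \<alpha>] by blast
  show thesis
  \<comment> \<open>\<open>h'\<close> is a prefix of \<open>h @ c\<close>, and both simple lists
    have at most \<open>card V\<close> vertices.\<close>
  proof (rule that[of "D * real (2 * card V)"])
    fix h c W x h' u assume g: "good h c W x" and e: "redge (Fam h c W x) (Pre h' u)"
    obtain s where s: "h @ c = h' @ s" and u: "u \<in> V"
      using e edges_V by (auto simp: red_edge_def)
    have hc: "set (h @ c) \<subseteq> V" "length (h @ c) \<le> 2 * card V"
      using good_h[OF g] good_c[OF g] by (auto simp: lists_V_def)
    then have V': "set (h' @ [u]) \<subseteq> V" "length h' \<le> 2 * card V"
      using u unfolding s by auto
    have in_V: "(h' @ [u]) ! k \<in> V" if "k \<le> length h'" for k
      using V'(1) that nth_mem[of k "h' @ [u]"] by fastforce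
    have "\<bar>pre_weight (gain \<alpha>) h' u\<bar> \<le> (\<Sum>k<length h'. \<bar>gain \<alpha> ((h' @ [u]) ! k, (h' @ [u]) ! Suc k)\<bar>)"
      unfolding pre_weight_def by (rule sum_abs)
    also have "\<dots> \<le> (\<Sum>k<length h'. D)"
      by (intro sum_mono D(2) in_V) auto
    also have "\<dots> \<le> D * real (2 * card V)"
      using V'(2) D(1) by (simp add: mult.commute[of _ D] del: of_nat_mult)
    finally show "\<bar>pre_weight (gain \<alpha>) h' u\<bar> \<le> D * real (2 * card V)" .
  qed
qed

text \<open>If every history satisfying \<open>Inv\<close> can be prolonged by one more round,
  dependent choice yields an infinite play; its energies stay above \<open>- K\<close>, so
  \<open>nu_ge_rounds\<close> applies.\<close>

lemma infinite_extension:
  assumes start: "chist \<sigma> hs0" "last hs0 = PSt v" "Inv v (0::real)"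
    and K: "\<And>v t. Inv v t \<Longrightarrow> - K \<le> t"
    and step: "\<And>hs v t. chist \<sigma> hs \<Longrightarrow> last hs = PSt v \<Longrightarrow> Inv v t \<Longrightarrow>
      \<exists>s1 s2 u t'. chist \<sigma> (hs @ [s1, s2, PSt u]) \<and> Inv u t' \<and>
        ((\<exists>h'. s2 = Pre h' u \<and> t' = t + pre_weight (gain \<alpha>) h' u) \<or>
         (\<exists>c. s2 = Post c u \<and> 0 \<le> cycle_weight (gain \<alpha>) c \<and> t' = 0))"
  shows "\<exists>\<pi>. legal \<pi> \<and> follows \<sigma> \<pi> \<and> ereal \<alpha> \<le> nu_C G i \<pi>"
proof -
  define ok where "ok X \<longleftrightarrow> chist \<sigma> (fst X) \<and> (\<exists>v. last (fst X) = PSt v \<and> Inv v (snd X))" for X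
  define nxt where "nxt X Y \<longleftrightarrow> (\<exists>s1 s2 u. fst Y = fst X @ [s1, s2, PSt u] \<and>
        ((\<exists>h'. s2 = Pre h' u \<and> snd Y = snd X + pre_weight (gain \<alpha>) h' u) \<or>
         (\<exists>c. s2 = Post c u \<and> 0 \<le> cycle_weight (gain \<alpha>) c \<and> snd Y = 0)))"
    for X Y :: "('v, 'p) rstate list \<times> real"
  have "\<exists>X. \<forall>n. (ok (X n) \<and> (n = 0 \<longrightarrow> X n = (hs0, 0))) \<and> nxt (X n) (X (Suc n))"
  proof (rule dependent_nat_choice)
    show "\<exists>X. ok X \<and> (0 = (0::nat) \<longrightarrow> X = (hs0, 0))" using start by (auto simp: ok_def)
    fix X and n :: nat assume "ok X \<and> (n = 0 \<longrightarrow> X = (hs0, 0))"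
    then obtain v where "chist \<sigma> (fst X)" "last (fst X) = PSt v" "Inv v (snd X)"
      by (auto simp: ok_def)
    from step[OF this] obtain s1 s2 u t' where *: "chist \<sigma> (fst X @ [s1, s2, PSt u])" "Inv u t'"
        "(\<exists>h'. s2 = Pre h' u \<and> t' = snd X + pre_weight (gain \<alpha>) h' u) \<or>
         (\<exists>c. s2 = Post c u \<and> 0 \<le> cycle_weight (gain \<alpha>) c \<and> t' = 0)" by blast
    then have "ok (fst X @ [s1, s2, PSt u], t')" "nxt X (fst X @ [s1, s2, PSt u], t')"
      unfolding ok_def nxt_def by auto
    then show "\<exists>Y. (ok Y \<and> (Suc n = 0 \<longrightarrow> Y = (hs0, 0))) \<and> nxt X Y" by blast
  qed
  then obtain X where X0: "X 0 = (hs0, 0)" and Xok: "\<And>n. ok (X n)" and Xn: "\<And>n. nxt (X n) (X (Suc n))"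
    by blast
  define H where "H n = fst (X n)" for n
  have H_Suc: "\<exists>s1 s2 u. H (Suc n) = H n @ [s1, s2, PSt u]" for n
    using Xn[of n] unfolding nxt_def H_def by blast
  have len: "length (H n) = length hs0 + 3 * n" for n
  proof (induction n)
    case (Suc n)
    then show ?case using H_Suc[of n] by auto
  qed (simp add: H_def X0)
  have hs0: "length hs0 > 0" using start(1) by (simp add: chist_def red_hist_def)
  have pref: "\<exists>l. H n = H m @ l" if "m \<le> n" for m n
    using that
  proof (induction n rule: dec_induct)
    case (step n)
    then show ?case using H_Suc[of n] by auto
  qed simp
  \<comment> \<open>A diagonal read-off: \<open>H k\<close> has more than \<open>k\<close> states,
    and each \<open>H n\<close> extends the earlier ones.\<close>
  define \<pi> where "\<pi> k = H k ! k" for k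
  have \<pi>: "H n ! k = \<pi> k" if k: "k < length (H n)" for n k
  proof (cases "k \<le> n")
    case True
    then obtain l where "H n = H k @ l" using pref by blast
    then show ?thesis using len[of k] hs0 by (simp add: \<pi>_def nth_append)
  next
    case False
    then obtain l where "H k = H n @ l" using pref[of n k] by auto
    then show ?thesis using k by (simp add: \<pi>_def nth_append)
  qed
  have "map \<pi> [0..<Suc n] = take (Suc n) (H n)" for n
  proof -
    have "Suc n \<le> length (H n)" using len[of n] hs0 by linarith
    then show ?thesis using \<pi>[of _ n] by (intro nth_equalityI) (auto simp del: upt_Suc)
  qed
  moreover have "chist \<sigma> (H n)" for n using Xok[of n] by (simp add: ok_def H_def)
  ultimately have lf: "legal \<pi> \<and> follows \<sigma> \<pi>"
    using chist_take by (intro chist_limit) simp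
  then have legal: "legal \<pi>" by blast
  have last_H: "\<exists>v. \<pi> (length hs0 + 3 * n - 1) = PSt v" for n
  proof -
    have "last (H n) = \<pi> (length (H n) - 1)"
      using \<pi>[of "length (H n) - 1" n] len[of n] hs0 by (subst last_conv_nth) auto
    then show ?thesis using Xok[of n] len[of n] by (auto simp: ok_def H_def)
  qed
  have nt: "\<pi> k \<noteq> Top" and nb: "\<pi> k \<noteq> Bot" for k
  proof -
    have "k \<le> length hs0 + 3 * k - 1" using hs0 by linarith
    then show "\<pi> k \<noteq> Top" "\<pi> k \<noteq> Bot"
      using last_H[of k] legal_Top[OF legal, of k "length hs0 + 3 * k - 1"]
        legal_Bot[OF legal, of k "length hs0 + 3 * k - 1"] by auto
  qed
  \<comment> \<open>By the period of the rounds, a history ending in a vertex stops at an index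
    divisible by three; \<open>J\<close> converts steps of the sequence into rounds.\<close>
  obtain J where J: "length hs0 = 3 * J + 1"
  proof -
    define k where "k = length hs0 - 1"
    obtain w where w: "\<pi> k = PSt w" using last_H[of 0] k_def by auto
    obtain v h c W x u where r: "\<pi> (3 * (k div 3)) = PSt v" "\<pi> (3 * (k div 3) + 1) = Fam h c W x" "good h c W x"
      "hd h = v" "\<pi> (3 * Suc (k div 3)) = PSt u" "u \<in> V" "redge (Fam h c W x) (\<pi> (3 * (k div 3) + 2))"
      and o: "(\<exists>h' s. \<pi> (3 * (k div 3) + 2) = Pre h' u \<and> h' \<noteq> [] \<and> h @ c = h' @ s)
        \<or> (\<pi> (3 * (k div 3) + 2) = Post c u \<and> (\<exists>v'\<in>W. owner G v' = i \<and> (v', u) \<in> edges G))"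
      by (rule round[OF legal nt nb, of "k div 3"])
    have "k \<noteq> 3 * (k div 3) + 1" "k \<noteq> 3 * (k div 3) + 2" using w r(2) o by auto
    then have "k = 3 * (k div 3)" by presburger
    then show thesis using that[of "k div 3"] hs0 k_def by linarith
  qed
  define t where "t j = snd (X (j - J))" for j
  have "ereal \<alpha> \<le> nu_C G i \<pi>"
  proof (rule nu_ge_rounds[OF legal nt nb, of J K t])
    fix j assume j: "J \<le> j"
    show "- K \<le> t j" using Xok[of "j - J"] K unfolding ok_def t_def by blast
    obtain s1 s2 u where n: "H (Suc (j - J)) = H (j - J) @ [s1, s2, PSt u]"
        "(\<exists>h'. s2 = Pre h' u \<and> snd (X (Suc (j - J))) = snd (X (j - J)) + pre_weight (gain \<alpha>) h' u) \<or>
         (\<exists>c. s2 = Post c u \<and> 0 \<le> cycle_weight (gain \<alpha>) c \<and> snd (X (Suc (j - J))) = 0)"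
      using Xn[of "j - J"] unfolding nxt_def H_def by blast
    have L: "length (H (j - J)) = 3 * j + 1" using len[of "j - J"] J j by simp
    have "\<pi> (3 * j + 2) = H (Suc (j - J)) ! (3 * j + 2)"
      using L n(1) by (intro \<pi>[symmetric]) simp
    also have "\<dots> = s2" using L unfolding n(1) by (simp add: nth_append)
    finally have "\<pi> (3 * j + 2) = s2" .
    then show "(\<exists>h' u. \<pi> (3 * j + 2) = Pre h' u \<and> t (Suc j) = t j + pre_weight (gain \<alpha>) h' u) \<or>
      (\<exists>c u. \<pi> (3 * j + 2) = Post c u \<and> 0 \<le> cycle_weight (gain \<alpha>) c \<and> t (Suc j) = 0)"
      using n(2) j unfolding t_def by (auto simp: Suc_diff_le)
  qed
  then show ?thesis using lf by blast
qed

text \<open>Challenger could punish any other choice at once: after \<open>Bot\<close> the payoff is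
  infinite, and a family with \<open>x i > \<alpha>\<close> would be accepted. Both contradict
  \<open>low\<close>.\<close>

lemma proposal_forced:
  assumes \<sigma>: "pstrat \<sigma>" and low: "\<And>\<pi>. legal \<pi> \<Longrightarrow> follows \<sigma> \<pi> \<Longrightarrow> nu_C G i \<pi> < ereal \<alpha>"
    and hs: "chist \<sigma> hs" "last hs = PSt v"
  shows "\<sigma> hs \<in> proposals \<alpha> v" and "chist \<sigma> (hs @ [\<sigma> hs])"
proof -
  have e: "redge (PSt v) (\<sigma> hs)"
    using \<sigma> hs unfolding prover_strategy_def chist_def is_prover_state_def by force
  show ch: "chist \<sigma> (hs @ [\<sigma> hs])" using e hs by (intro chist_snoc) auto
  have len: "length hs > 0" using hs(1) by (simp add: chist_def red_hist_def)
  have "\<sigma> hs \<noteq> Bot"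
  proof
    assume "\<sigma> hs = Bot"
    then have lf: "legal (lconc (hs @ [Bot]) (\<lambda>_. Bot)) \<and> follows \<sigma> (lconc (hs @ [Bot]) (\<lambda>_. Bot))"
      using ch by (intro chist_sink) auto
    have "lconc (hs @ [Bot]) (\<lambda>_. Bot) (length hs) = Bot" by (simp add: lconc_def)
    then have "nu_C G i (lconc (hs @ [Bot]) (\<lambda>_. Bot)) = \<infinity>" unfolding nu_C_def by auto
    then show False using low lf by fastforce
  qed
  then obtain h c W x where F: "\<sigma> hs = Fam h c W x" "good h c W x" "hd h = v"
    using e by (auto simp: red_edge_def)
  have "x i \<le> \<alpha>"
  proof (rule ccontr)
    assume x: "\<not> x i \<le> \<alpha>"
    let ?\<pi> = "lconc (hs @ [Fam h c W x, Top]) (\<lambda>_. Top)"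
    have "chist \<sigma> ((hs @ [Fam h c W x]) @ [Top])"
      using F(2) by (intro chist_snoc[OF ch[unfolded F(1)]]) (auto simp: red_edge_def is_prover_state_def)
    then have lf: "legal ?\<pi>" "follows \<sigma> ?\<pi>"
      using chist_sink[of \<sigma> "hs @ [Fam h c W x, Top]" Top] by auto
    have at: "?\<pi> (length hs) = Fam h c W x" "?\<pi> (Suc (length hs)) = Top"
      by (simp_all add: lconc_def nth_append)
    obtain j h1 c1 W1 x1 where j: "?\<pi> j = Fam h1 c1 W1 x1" "?\<pi> (Suc j) = Top"
      "nu_C G i ?\<pi> = ereal (x1 i)"
      by (rule nu_Top[OF lf(1) at(2)])
    \<comment> \<open>\<open>nu_Top\<close> names some acceptance; as \<open>Top\<close> is
      absorbing, it is the one just appended.\<close>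
    have "\<not> Suc j \<le> length hs" using legal_Top[OF lf(1) j(2), of "length hs"] at(1) by auto
    moreover have "\<not> Suc (length hs) \<le> j" using legal_Top[OF lf(1) at(2), of j] j(1) by auto
    ultimately have "j = length hs" by simp
    then have "x1 = x" using j(1) at(1) by simp
    then show False using low[OF lf] j(3) x by simp
  qed
  then show "\<sigma> hs \<in> proposals \<alpha> v" using F by (auto simp: proposals_def)
qed

text \<open>The new vertices are stacked on top: they receive one rank above all ranks in
  \<open>Y\<close>, and vertices of \<open>Y\<close> keep their data. A move from the new layer into
  \<open>Y\<close> then lowers the rank, and a pre-cycle deviation within the layer is paid by
  \<open>f'\<close>.\<close>

lemma certified_extend:
  assumes cert: "certified \<alpha> Z Y act rk f" and U: "U \<subseteq> V"
    and step: "\<And>v. v \<in> U \<Longrightarrow> 0 \<le> f' v \<and> act' v \<in> proposals \<alpha> v \<and>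
      (\<forall>h' u. redge (act' v) (Pre h' u) \<longrightarrow> u \<in> U \<and> f' u \<le> f' v - pre_weight (gain \<alpha>) h' u) \<and>
      (\<forall>c u. redge (act' v) (Post c u) \<longrightarrow> (if 0 \<le> cycle_weight (gain \<alpha>) c then u \<in> Y else u \<in> Z))"
  shows "\<exists>act rk f. certified \<alpha> Z (Y \<union> U) act rk f"
proof -
  have Y: "Y \<subseteq> V" using cert by (simp add: certified_def)
  then have fin: "finite Y" using finite_V finite_subset by blast
  define r where "r = Suc (\<Sum>v\<in>Y. rk v)"
  have r: "rk v < r" if "v \<in> Y" for v
    unfolding r_def less_Suc_eq_le using fin that by (intro member_le_sum) auto
  define act2 where "act2 v = (if v \<in> Y then act v else act' v)" for v
  define rk2 where "rk2 v = (if v \<in> Y then rk v else r)" for v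
  define f2 where "f2 v = (if v \<in> Y then f v else f' v)" for v
  have "0 \<le> f2 v \<and> act2 v \<in> proposals \<alpha> v \<and>
     (\<forall>h' u. redge (act2 v) (Pre h' u) \<longrightarrow> u \<in> Y \<union> U \<and>
        (rk2 u < rk2 v \<or> rk2 u = rk2 v \<and> f2 u \<le> f2 v - pre_weight (gain \<alpha>) h' u)) \<and>
     (\<forall>c u. redge (act2 v) (Post c u) \<longrightarrow>
        (if 0 \<le> cycle_weight (gain \<alpha>) c then u \<in> Y \<union> U \<and> rk2 u < rk2 v else u \<in> Z))"
    if v: "v \<in> Y \<union> U" for v
  proof (cases "v \<in> Y")
    case True
    have c: "0 \<le> f v" "act v \<in> proposals \<alpha> v"
      "\<And>h' u. redge (act v) (Pre h' u) \<Longrightarrow> u \<in> Y \<and>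
        (rk u < rk v \<or> rk u = rk v \<and> f u \<le> f v - pre_weight (gain \<alpha>) h' u)"
      "\<And>c u. redge (act v) (Post c u) \<Longrightarrow>
        (if 0 \<le> cycle_weight (gain \<alpha>) c then u \<in> Y \<and> rk u < rk v else u \<in> Z)"
      using cert True unfolding certified_def by blast+
    have "act2 v = act v" "rk2 v = rk v" "f2 v = f v" using True by (auto simp: act2_def rk2_def f2_def)
    moreover have "rk2 u = rk u" "f2 u = f u" if "u \<in> Y" for u using that by (auto simp: rk2_def f2_def)
    ultimately show ?thesis using c(1,2) c(3) c(4) by (metis UnI1)
  next
    case False
    then have vU: "v \<in> U" using v by blast
    have s: "0 \<le> f' v" "act' v \<in> proposals \<alpha> v"
      "\<And>h' u. redge (act' v) (Pre h' u) \<Longrightarrow> u \<in> U \<and> f' u \<le> f' v - pre_weight (gain \<alpha>) h' u"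
      "\<And>c u. redge (act' v) (Post c u) \<Longrightarrow> (if 0 \<le> cycle_weight (gain \<alpha>) c then u \<in> Y else u \<in> Z)"
      using step[OF vU] by blast+
    have v2: "act2 v = act' v" "rk2 v = r" "f2 v = f' v" using False by (auto simp: act2_def rk2_def f2_def)
    have "rk2 u < r" if "u \<in> Y" for u using that r by (simp add: rk2_def)
    moreover have "rk2 u = r \<and> f2 u = f' u" if "u \<notin> Y" for u using that by (simp add: rk2_def f2_def)
    ultimately show ?thesis unfolding v2 using s(1,2) s(3) s(4) by (metis UnCI)
  qed
  then have "certified \<alpha> Z (Y \<union> U) act2 rk2 f2" using Y U unfolding certified_def by blast
  then show ?thesis by blast
qed

lemma exists_certified:
  assumes \<sigma>: "pstrat \<sigma>" and low: "\<And>\<pi>. legal \<pi> \<Longrightarrow> follows \<sigma> \<pi> \<Longrightarrow> nu_C G i \<pi> < ereal \<alpha>"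
  shows "\<exists>Y act rk f. certified \<alpha> Y Y act rk f \<and> v0 \<in> Y"
proof -
  define Z where "Z = {v. \<exists>hs. chist \<sigma> hs \<and> last hs = PSt v}"
  define CY where "CY = {Y. \<exists>act rk f. certified \<alpha> Z Y act rk f}"
  have "finite CY"
    by (rule finite_subset[of _ "Pow V"]) (auto simp: CY_def certified_def finite_V)
  moreover have "{} \<in> CY" unfolding CY_def certified_def by blast
  ultimately obtain Y where Y: "Y \<in> CY" "\<And>Y'. Y' \<in> CY \<Longrightarrow> Y \<subseteq> Y' \<Longrightarrow> Y' = Y"
    using finite_has_maximal[of CY] by blast
  obtain act rk f where cert: "certified \<alpha> Z Y act rk f" using Y(1) unfolding CY_def by blast

  \<comment> \<open>Prover may use only proposals whose post-cycle deviations are already dealt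
    with, so that pre-cycle deviations are the only moves left to the opponent of the energy
    game.\<close>
  define A where "A v = {a \<in> proposals \<alpha> v. \<forall>c u. redge a (Post c u) \<longrightarrow>
      (if 0 \<le> cycle_weight (gain \<alpha>) c then u \<in> Y else u \<in> Z)}" for v
  define M where "M a = {(pre_weight (gain \<alpha>) h' u, u) | h' u. redge a (Pre h' u)}" for a
  obtain C where C: "\<And>h c W x h' u. good h c W x \<Longrightarrow> redge (Fam h c W x) (Pre h' u) \<Longrightarrow>
    \<bar>pre_weight (gain \<alpha>) h' u\<bar> \<le> C"
    using pre_weight_bound[of \<alpha>] by blast
  have finA: "finite (A v)" for v
    by (rule finite_subset[OF _ finite_proposals]) (auto simp: A_def)
  have AM: "u \<in> V \<and> \<bar>w\<bar> \<le> C" if va: "v \<in> V" "a \<in> A v" "(w, u) \<in> M a" for v a w u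
  proof -
    obtain h c W x where a: "a = Fam h c W x" "good h c W x"
      using va(2) by (auto simp: A_def proposals_def)
    obtain h' where h': "w = pre_weight (gain \<alpha>) h' u" "redge a (Pre h' u)"
      using va(3) by (auto simp: M_def)
    have "state_ok a" using a by (simp add: state_ok_def)
    then have "state_ok (Pre h' u :: ('v, 'p) rstate)" using state_ok_step h'(2) by blast
    then show ?thesis using C[of h c W x h' u] a h' by (simp add: state_ok_def)
  qed
  obtain U f' Inv K where U: "U \<subseteq> V"
    and f'0: "\<And>v. v \<in> U \<Longrightarrow> (0::real) \<le> f' v"
    and f': "\<And>v. v \<in> U \<Longrightarrow> \<exists>a\<in>A v. \<forall>(w, u)\<in>M a. u \<in> U \<and> f' u \<le> f' v - w"
    and Inv0: "\<And>v. v \<in> V - U \<Longrightarrow> Inv v 0"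
    and InvK: "\<And>v t. Inv v t \<Longrightarrow> - K \<le> (t::real)"
    and Inv_step: "\<And>v t a. Inv v t \<Longrightarrow> a \<in> A v \<Longrightarrow> \<exists>(w, u)\<in>M a. Inv u (t + w)"
    by (rule energy_dichotomy[of V A M C, OF finite_V finA AM]) blast+
  \<comment> \<open>The potential region would enlarge the certificate, so maximality places it
    inside \<open>Y\<close>.\<close>
  have UY: "U \<subseteq> Y"
  proof -
    obtain act' where act': "\<And>v. v \<in> U \<Longrightarrow> act' v \<in> A v \<and> (\<forall>(w, u)\<in>M (act' v). u \<in> U \<and> f' u \<le> f' v - w)"
      using f' by metis
    have "\<exists>act rk f. certified \<alpha> Z (Y \<union> U) act rk f"
    proof (rule certified_extend[OF cert U])
      fix v assume v: "v \<in> U"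
      have "act' v \<in> proposals \<alpha> v"
        "\<forall>c u. redge (act' v) (Post c u) \<longrightarrow> (if 0 \<le> cycle_weight (gain \<alpha>) c then u \<in> Y else u \<in> Z)"
        using act'[OF v] unfolding A_def by blast+
      moreover have "u \<in> U \<and> f' u \<le> f' v - pre_weight (gain \<alpha>) h' u" if "redge (act' v) (Pre h' u)" for h' u
      proof -
        have "(pre_weight (gain \<alpha>) h' u, u) \<in> M (act' v)" using that unfolding M_def by blast
        then show ?thesis using act'[OF v] by blast
      qed
      ultimately show "0 \<le> f' v \<and> act' v \<in> proposals \<alpha> v \<and>
        (\<forall>h' u. redge (act' v) (Pre h' u) \<longrightarrow> u \<in> U \<and> f' u \<le> f' v - pre_weight (gain \<alpha>) h' u) \<and>
        (\<forall>c u. redge (act' v) (Post c u) \<longrightarrow> (if 0 \<le> cycle_weight (gain \<alpha>) c then u \<in> Y else u \<in> Z))"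
        using f'0[OF v] by blast
    qed
    then have "Y \<union> U = Y" by (intro Y(2)) (auto simp: CY_def)
    then show ?thesis by blast
  qed

  have ext: "\<exists>s1 s2 u t'. chist \<sigma> (hs @ [s1, s2, PSt u]) \<and> Inv u t' \<and>
        ((\<exists>h'. s2 = Pre h' u \<and> t' = t + pre_weight (gain \<alpha>) h' u) \<or>
         (\<exists>c. s2 = Post c u \<and> 0 \<le> cycle_weight (gain \<alpha>) c \<and> t' = 0))"
    if hs: "chist \<sigma> hs" "last hs = PSt v" and I: "Inv v t" for hs v t
  proof -
    let ?a = "\<sigma> hs"
    note a = proposal_forced[OF \<sigma> low hs]
    have np: "\<not> is_prover_state ?a" using a(1) by (auto simp: proposals_def is_prover_state_def)
    have ch3: "chist \<sigma> (hs @ [?a, s2, PSt u])"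
      if e: "redge ?a s2" and s2: "(\<exists>h'. s2 = Pre h' u) \<or> (\<exists>c. s2 = Post c u)" for s2 u
    proof -
      have "chist \<sigma> ((hs @ [?a]) @ [s2])" using np e by (intro chist_snoc[OF a(2)]) auto
      then have "chist \<sigma> (((hs @ [?a]) @ [s2]) @ [PSt u])"
        using s2 by (elim chist_snoc) (auto simp: red_edge_def is_prover_state_def)
      then show ?thesis by simp
    qed
    show ?thesis
    proof (cases "?a \<in> A v")
      case True
      then obtain w u where wu: "(w, u) \<in> M ?a" "Inv u (t + w)" using Inv_step[OF I] by blast
      then obtain h' where h': "w = pre_weight (gain \<alpha>) h' u" "redge ?a (Pre h' u)"
        by (auto simp: M_def)
      then show ?thesis using ch3[of "Pre h' u" u] wu(2) by blast
    next
      case False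
      then obtain c u where cu: "redge ?a (Post c u)"
        "\<not> (if 0 \<le> cycle_weight (gain \<alpha>) c then u \<in> Y else u \<in> Z)"
        using a(1) unfolding A_def by blast
      have ch: "chist \<sigma> (hs @ [?a, Post c u, PSt u])" using ch3 cu(1) by blast
      \<comment> \<open>The deviation prolongs a history under \<open>\<sigma>\<close>, so its
        target lies in \<open>Z\<close> and a cheap cycle cannot be the reason for the failure. The
        cycle is expensive and leads outside \<open>Y\<close>, where the energy may restart at
        \<open>0\<close>.\<close>
      then have "u \<in> Z" unfolding Z_def by force
      then have c: "0 \<le> cycle_weight (gain \<alpha>) c" "u \<notin> Y" using cu(2) by (auto split: if_splits)
      have "state_ok (PSt u :: ('v, 'p) rstate)"
        using red_hist_last_ok[of "hs @ [?a, Post c u, PSt u]"] ch by (simp add: chist_def)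
      then have "Inv u 0" using c(2) UY by (intro Inv0) (auto simp: state_ok_def)
      then show ?thesis using ch c(1) by blast
    qed
  qed
  have ZY: "Z \<subseteq> Y"
  proof
    fix v assume "v \<in> Z"
    then obtain hs where hs: "chist \<sigma> hs" "last hs = PSt v" unfolding Z_def by blast
    show "v \<in> Y"
    proof (rule ccontr)
      assume "v \<notin> Y"
      moreover have "v \<in> V" using red_hist_last_ok[of hs] hs by (simp add: chist_def state_ok_def)
      ultimately have "Inv v 0" using UY by (intro Inv0) blast
      then have "\<exists>\<pi>. legal \<pi> \<and> follows \<sigma> \<pi> \<and> ereal \<alpha> \<le> nu_C G i \<pi>"
        by (rule infinite_extension[where K = K, OF hs]) (erule InvK, erule (2) ext)
      then show False using low by (meson not_le)
    qed
  qed
  \<comment> \<open>Cheap cycles lead into \<open>Z\<close>, hence back into \<open>Y\<close>: the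
    certificate becomes self-contained.\<close>
  have "certified \<alpha> Y Y act rk f"
    using cert ZY unfolding certified_def by (meson subsetD)
  moreover have "v0 \<in> Z" unfolding Z_def using chist_start[of \<sigma>] by force
  ultimately show ?thesis using ZY by blast
qed

section \<open>The best memoryless strategy\<close>

lemma memoryless_improves:
  assumes \<sigma>: "pstrat \<sigma>" and less: "guarantee \<sigma> < ereal \<alpha>"
  shows "\<exists>s\<in>PiE V (\<lambda>v. {t. redge (PSt v) t}). guarantee (mstrat s) \<le> ereal \<alpha>"
proof -
  have low: "nu_C G i \<pi> < ereal \<alpha>" if "legal \<pi>" "follows \<sigma> \<pi>" for \<pi>
    using nu_le_guarantee[OF that] less by (rule order.strict_trans1)
  obtain Y act rk f where cert: "certified \<alpha> Y Y act rk f" and Y: "v0 \<in> Y"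
    using exists_certified[OF \<sigma>, of \<alpha>] low by blast
  \<comment> \<open>Outside \<open>Y\<close>, which the play never reaches, Prover gives up;
    \<open>restrict\<close> places \<open>s\<close> in a finite function space.\<close>
  define s where "s = restrict (\<lambda>v. if v \<in> Y then act v else Bot) V"
  have prp: "act v \<in> proposals \<alpha> v" "v \<in> V" if "v \<in> Y" for v
    using cert that unfolding certified_def by blast+
  have s: "s \<in> PiE V (\<lambda>v. {t. redge (PSt v) t})"
  proof -
    have "redge (PSt v) (act v)" if "v \<in> Y" for v
      using prp[OF that] by (auto simp: red_edge_def proposals_def)
    moreover have "redge (PSt v) Bot" if "v \<in> V" for v using that by (simp add: red_edge_def)
    ultimately show ?thesis unfolding s_def by auto
  qed
  have "guarantee (mstrat s) \<le> ereal \<alpha>"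
    unfolding prover_guarantee_def
  proof (rule SUP_least)
    fix \<tau> assume "\<tau> \<in> {\<tau>. cstrat \<tau>}"
    then have lf: "legal (outcome (mstrat s) \<tau> v0) \<and> follows (mstrat s) (outcome (mstrat s) \<tau> v0)"
      using s by (intro outcome_legal mstrat_strategy) auto
    show "nu_C G i (outcome (mstrat s) \<tau> v0) \<le> ereal \<alpha>"
    proof (rule certified_bound[OF cert Y])
      fix k v assume k: "outcome (mstrat s) \<tau> v0 k = PSt v" and v: "v \<in> Y"
      have "outcome (mstrat s) \<tau> v0 (Suc k) = mstrat s (map (outcome (mstrat s) \<tau> v0) [0..<Suc k])"
        using conjunct2[OF lf, unfolded follows_def, rule_format, of k] k
        by (simp add: is_prover_state_def)
      also have "\<dots> = s v" by (simp add: mstrat_def k)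
      finally show "outcome (mstrat s) \<tau> v0 (Suc k) = act v" using v prp(2)[OF v] by (simp add: s_def)
    qed (use lf in blast)
  qed
  then show ?thesis using s by blast
qed

lemma optimal_memoryless:
  "\<exists>\<sigma>. optimal_prover G lam i \<beta> v0 \<sigma> \<and> memoryless_prover G lam i \<beta> v0 \<sigma>"
proof -
  let ?S = "PiE V (\<lambda>v. {t. redge (PSt v) t})"
  have "{t. redge (PSt v) t} \<subseteq> insert Bot {Fam h c W x | h c W x. good h c W x}" for v
    by (auto simp: red_edge_def)
  from finite_subset[OF this finite.insertI[OF finite_families]]
  have "finite {t. redge (PSt v) t}" for v .
  then have fin: "finite ?S" using finite_V by (intro finite_PiE)
  have "restrict (\<lambda>_. Bot) V \<in> ?S" by (auto simp: red_edge_def)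
  then have ne: "?S \<noteq> {}" by blast
  obtain s where s: "s \<in> ?S" "\<And>s'. s' \<in> ?S \<Longrightarrow> guarantee (mstrat s) \<le> guarantee (mstrat s')"
    using arg_min_if_finite(1)[OF fin ne, of "\<lambda>s. guarantee (mstrat s)"]
      arg_min_least[OF fin ne, of _ "\<lambda>s. guarantee (mstrat s)"] by blast
  have ps: "pstrat (mstrat s)" using s(1) by (intro mstrat_strategy) auto
  have "guarantee (mstrat s) = (INF \<sigma>'\<in>{\<sigma>'. pstrat \<sigma>'}. guarantee \<sigma>')"
  proof (rule order_antisym)
    show "guarantee (mstrat s) \<le> (INF \<sigma>'\<in>{\<sigma>'. pstrat \<sigma>'}. guarantee \<sigma>')"
    proof (rule INF_greatest)
      fix \<sigma> assume "\<sigma> \<in> {\<sigma>'. pstrat \<sigma>'}"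
      then have \<sigma>: "pstrat \<sigma>" by simp
      show "guarantee (mstrat s) \<le> guarantee \<sigma>"
      proof (rule ccontr)
        assume "\<not> ?thesis"
        \<comment> \<open>A real value strictly in between: the improved strategy attains it only
          weakly, which still beats the minimum \<open>s\<close>.\<close>
        then obtain \<alpha> where \<alpha>: "guarantee \<sigma> < ereal \<alpha>" "ereal \<alpha> < guarantee (mstrat s)"
          using ereal_dense2 by (meson not_le)
        from memoryless_improves[OF \<sigma> \<alpha>(1)] obtain s' where "s' \<in> ?S" "guarantee (mstrat s') \<le> ereal \<alpha>"
          by blast
        then show False using s(2)[of s'] \<alpha>(2) by simp
      qed
    qed
    show "(INF \<sigma>'\<in>{\<sigma>'. pstrat \<sigma>'}. guarantee \<sigma>') \<le> guarantee (mstrat s)"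
      using ps by (intro INF_lower) simp
  qed
  then show ?thesis using ps mstrat_memoryless unfolding optimal_prover_def by blast
qed

end

theorem lemma7:
  fixes G :: "('v, 'p::finite) mpg" and lam :: "'v \<Rightarrow> ereal"
    and i :: 'p and v0 :: 'v and \<beta> :: nat
  assumes "mp_game G" and "v0 \<in> verts G" and "owner G v0 = i"
  shows "\<exists>\<sigma>. optimal_prover G lam i \<beta> v0 \<sigma> \<and> memoryless_prover G lam i \<beta> v0 \<sigma>"
proof -
  interpret red_game G lam i \<beta> v0 by unfold_locales (fact assms(1), fact assms(2))
  show ?thesis by (rule optimal_memoryless)
qed

end
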